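(* Let $A$ and $B$ be DG rings, and let $\Lambda^q_i$ be a horn in $\Delta^q$. Then there is a canonical bijection \[ \operatorname{Hom}_{\mathsf{SSet}}\bigl( \Lambda^q_i, \operatorname{SHom}(A,B) \bigr) \cong \operatorname{Hom}_{\mathsf{DGRng}}\bigl( A, \operatorname{N}(\Lambda^q_i, B) \bigr). \]
   Context: A DG ring is a graded ring $A = \bigoplus_{i \in \mathbb{Z}} A^i$ (associative, unital) with a differential $\mathrm{d}$ of degree $1$ satisfying $\mathrm{d} \circ \mathrm{d} = 0$ and $\mathrm{d}(a b) = \mathrm{d}(a) b + (-1)^i a\, \mathrm{d}(b)$ for $a \in A^i$. DG ring homomorphisms are unital, degree $0$, and commute with differentials; $\mathsf{DGRng}$ is the category of DG rings. $\mathsf{SSet}$ is the category of simplicial sets. $\Delta^q$ is the standard $q$-simplex, with $\Delta^q_p$ the set of nondecreasing functions $[p] \to [q]$, where $[p] = \{0,\ldots,p\}$. For $0 \leq i \leq q$ the horn $\Lambda^q_i \subseteq \Delta^q$ is the simplicial subset consisting of the nondecreasing functions $\sigma : [p] \to [q]$ such that $\sigma([p]) \cup \{i\} \neq [q]$. The DG rings $\operatorname{N}(X,B)$: for a simplicial set $X$, with face maps $\partial_i$, let $\operatorname{N}^p(X,\mathbb{Z})$ be the group of functions $\phi : X_p \to \mathbb{Z}$ vanishing on degenerate simplices, and $\operatorname{N}(X,\mathbb{Z}) := \bigoplus_{p \geq 0} \operatorname{N}^p(X,\mathbb{Z})$. It is a DG ring with differential $(\mathrm{d}\phi)(x) = \sum_{i=0}^{p+1}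 (-1)^i \phi(\partial_i x)$ for $\phi\in \operatorname{N}^p$, and Alexander-Whitney multiplication $(\phi * \psi)(x) = \phi(\partial_{>p}(x)) \cdot \psi(\partial_{<p}(x))$ for $\phi \in \operatorname{N}^p$, $\psi \in \operatorname{N}^q$, $x \in X_{p+q}$, where $\partial_{>p}(x) \in X_p$ is the front face of $x$ (induced by $[p] \to [p+q]$, $i \mapsto i$) and $\partial_{<p}(x) \in X_q$ is the back face (induced by $[q] \to [p+q]$, $i \mapsto p+i$). For a DG ring $B$ set $\operatorname{N}(X,B) := \operatorname{N}(X,\mathbb{Z}) \otimes_{\mathbb{Z}} B$, the tensor product of DG rings with the usual Koszul signs. This is contravariantly functorial in $X$ and covariantly functorial in $B$. Cylinders: $\operatorname{Cyl}_q(B) := \operatorname{N}(\Delta^q, B)$; the cosimplicial structure of $\{\Delta^q\}_{q}$ makes $\{\operatorname{Cyl}_q(B)\}_{q \in \mathbb{N}}$ a simplicial DG ring. $\operatorname{SHom}(A,B)$ is the simplicial set with $\operatorname{SHom}_q(A,B) := \operatorname{Hom}_{\mathsf{DGRng}}(A, \operatorname{Cyl}_q(B))$. *)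

theory Defs
  imports "HOL-Algebra.Free_Abelian_Groups" "HOL-Algebra.RingHom"
begin

section \<open>DG rings\<close>

text \<open>
  \<open>dg_part A i\<close> is the subgroup \<open>A\<^sup>i\<close> of homogeneous elements of degree \<open>i\<close>;
  the decomposition \<open>A = \<Oplus>\<^sub>i A\<^sup>i\<close> is internal.
\<close>

record 'a dg_ring = "'a ring" +
  dg_part :: "int \<Rightarrow> 'a set"
  dg_d :: "'a \<Rightarrow> 'a"

text \<open>\<open>(-1)\<^sup>n\<close> as an integer, for an integer exponent, and the action of this sign on a ring.\<close>

definition ksign :: "int \<Rightarrow> int" where
  "ksign n = (if even n then 1 else -1)"

definition dg_signed :: "'a dg_ring \<Rightarrow> int \<Rightarrow> 'a \<Rightarrow> 'a" where
  "dg_signed A n x = (if even n then x else \<ominus>\<^bsub>A\<^esub> x)"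

definition homogeneous_decomp :: "'a dg_ring \<Rightarrow> 'a \<Rightarrow> (int \<Rightarrow> 'a) \<Rightarrow> bool" where
  "homogeneous_decomp A x c \<longleftrightarrow>
     (\<forall>i. c i \<in> dg_part A i) \<and> finite {i. c i \<noteq> \<zero>\<^bsub>A\<^esub>} \<and>
     x = finsum A c {i. c i \<noteq> \<zero>\<^bsub>A\<^esub>}"

locale dg_ring = ring A for A :: "'a dg_ring" (structure) +
  assumes part_subgroup: "additive_subgroup (dg_part A i) A"
    and direct_sum: "x \<in> carrier A \<Longrightarrow> \<exists>!c. homogeneous_decomp A x c"
    and one_degree: "\<one> \<in> dg_part A 0"
    and mult_degree: "\<lbrakk>x \<in> dg_part A i; y \<in> dg_part A j\<rbrakk> \<Longrightarrow> x \<otimes> y \<in> dg_part A (i + j)"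
    and d_closed: "x \<in> carrier A \<Longrightarrow> dg_d A x \<in> carrier A"
    and d_add: "\<lbrakk>x \<in> carrier A; y \<in> carrier A\<rbrakk> \<Longrightarrow> dg_d A (x \<oplus> y) = dg_d A x \<oplus> dg_d A y"
    and d_degree: "x \<in> dg_part A i \<Longrightarrow> dg_d A x \<in> dg_part A (i + 1)"
    and d_d: "x \<in> carrier A \<Longrightarrow> dg_d A (dg_d A x) = \<zero>"
    and d_mult: "\<lbrakk>x \<in> dg_part A i; y \<in> carrier A\<rbrakk> \<Longrightarrow>
        dg_d A (x \<otimes> y) = dg_d A x \<otimes> y \<oplus> dg_signed A i (x \<otimes> dg_d A y)"

text \<open>
  The set of DG ring homomorphisms. As functions are total in HOL, they are taken to be
  \<open>undefined\<close> outside the carrier, so that equality of homomorphisms is equality on the carrier.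
\<close>

definition dg_hom :: "'a dg_ring \<Rightarrow> 'b dg_ring \<Rightarrow> ('a \<Rightarrow> 'b) set" where
  "dg_hom A B = {h \<in> ring_hom A B. h \<in> extensional (carrier A) \<and>
     (\<forall>i. \<forall>x \<in> dg_part A i. h x \<in> dg_part B i) \<and>
     (\<forall>x \<in> carrier A. h (dg_d A x) = dg_d B (h x))}"

definition dg_comp :: "'a dg_ring \<Rightarrow> int \<Rightarrow> 'a \<Rightarrow> 'a" where
  "dg_comp A i x = (THE c. homogeneous_decomp A x c) i"

definition dg_supp :: "'a dg_ring \<Rightarrow> 'a \<Rightarrow> int set" where
  "dg_supp A x = {i. dg_comp A i x \<noteq> \<zero>\<^bsub>A\<^esub>}"


section \<open>The tensor product of DG rings over the integers\<close>

text \<open>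
  The underlying abelian group of \<open>M \<otimes> N\<close> is the free abelian group on pairs of elements modulo
  the subgroup generated by the biadditivity relations (these imply balancedness over the integers).
  Elements are cosets.
\<close>

abbreviation tensor_free :: "'a dg_ring \<Rightarrow> 'b dg_ring \<Rightarrow> ('a \<times> 'b \<Rightarrow>\<^sub>0 int) monoid" where
  "tensor_free M N \<equiv> free_Abelian_group (carrier M \<times> carrier N)"

definition tensor_rel :: "'a dg_ring \<Rightarrow> 'b dg_ring \<Rightarrow> ('a \<times> 'b \<Rightarrow>\<^sub>0 int) set" where
  "tensor_rel M N = generate (tensor_free M N)
     ({frag_of (x \<oplus>\<^bsub>M\<^esub> x', y) - frag_of (x, y) - frag_of (x', y) | x x' y.
         x \<in> carrier M \<and> x' \<in> carrier M \<and> y \<in> carrier N} \<union>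
      {frag_of (x, y \<oplus>\<^bsub>N\<^esub> y') - frag_of (x, y) - frag_of (x, y') | x y y'.
         x \<in> carrier M \<and> y \<in> carrier N \<and> y' \<in> carrier N})"

definition tensor_group :: "'a dg_ring \<Rightarrow> 'b dg_ring \<Rightarrow> ('a \<times> 'b \<Rightarrow>\<^sub>0 int) set monoid" where
  "tensor_group M N = tensor_free M N Mod tensor_rel M N"

definition tensor_class ::
    "'a dg_ring \<Rightarrow> 'b dg_ring \<Rightarrow> ('a \<times> 'b \<Rightarrow>\<^sub>0 int) \<Rightarrow> ('a \<times> 'b \<Rightarrow>\<^sub>0 int) set" where
  "tensor_class M N u = tensor_rel M N #>\<^bsub>tensor_free M N\<^esub> u"

definition pure_tensor :: "'a dg_ring \<Rightarrow> 'b dg_ring \<Rightarrow> 'a \<Rightarrow> 'b \<Rightarrow> ('a \<times> 'b \<Rightarrow>\<^sub>0 int) set" where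
  "pure_tensor M N x y = tensor_class M N (frag_of (x, y))"

text \<open>
  Representative of \<open>(x \<otimes> y) \<cdot> (x' \<otimes> y')\<close>. The Koszul rule
  \<open>(x \<otimes> y) \<cdot> (x' \<otimes> y') = (-1)\<^bsup>ij\<^esup> x x' \<otimes> y y'\<close> for \<open>y\<close> of degree \<open>i\<close> and \<open>x'\<close> of
  degree \<open>j\<close> is extended to arbitrary elements by splitting \<open>y\<close> and \<open>x'\<close> into homogeneous
  components; similarly for \<open>d (x \<otimes> y) = d x \<otimes> y + (-1)\<^sup>i x \<otimes> d y\<close> with \<open>x\<close> of degree \<open>i\<close>.
\<close>

definition tensor_mult_gen ::
    "'a dg_ring \<Rightarrow> 'b dg_ring \<Rightarrow> 'a \<times> 'b \<Rightarrow> 'a \<times> 'b \<Rightarrow> ('a \<times> 'b \<Rightarrow>\<^sub>0 int)" where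
  "tensor_mult_gen M N = (\<lambda>(x, y) (x', y').
     \<Sum>i \<in> dg_supp N y. \<Sum>j \<in> dg_supp M x'.
       frag_cmul (ksign (i * j))
         (frag_of (x \<otimes>\<^bsub>M\<^esub> dg_comp M j x', dg_comp N i y \<otimes>\<^bsub>N\<^esub> y')))"

definition tensor_d_gen ::
    "'a dg_ring \<Rightarrow> 'b dg_ring \<Rightarrow> 'a \<times> 'b \<Rightarrow> ('a \<times> 'b \<Rightarrow>\<^sub>0 int)" where
  "tensor_d_gen M N = (\<lambda>(x, y). frag_of (dg_d M x, y) +
     (\<Sum>i \<in> dg_supp M x. frag_cmul (ksign i) (frag_of (dg_comp M i x, dg_d N y))))"

text \<open>
  Operations on cosets are given by the operation on representatives; the union over all
  representatives is a single coset, since the operation respects the relations.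
\<close>

definition tensor_dg :: "'a dg_ring \<Rightarrow> 'b dg_ring \<Rightarrow> ('a \<times> 'b \<Rightarrow>\<^sub>0 int) set dg_ring" where
  "tensor_dg M N = \<lparr>
     carrier = carrier (tensor_group M N),
     mult = (\<lambda>U V. \<Union>u\<in>U. \<Union>v\<in>V. tensor_class M N
               (frag_extend (\<lambda>g. frag_extend (\<lambda>g'. tensor_mult_gen M N g g') v) u)),
     one = pure_tensor M N \<one>\<^bsub>M\<^esub> \<one>\<^bsub>N\<^esub>,
     zero = \<one>\<^bsub>tensor_group M N\<^esub>,
     add = (\<otimes>\<^bsub>tensor_group M N\<^esub>),
     dg_part = (\<lambda>n. generate (tensor_group M N)
               {pure_tensor M N x y | x y i j.
                  x \<in> dg_part M i \<and> y \<in> dg_part N j \<and> i + j = n}),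
     dg_d = (\<lambda>U. \<Union>u\<in>U. tensor_class M N (frag_extend (tensor_d_gen M N) u))\<rparr>"

text \<open>The map \<open>h \<otimes> k : M \<otimes> N \<rightarrow> M' \<otimes> N'\<close>.\<close>

definition tensor_map ::
    "'a dg_ring \<Rightarrow> 'b dg_ring \<Rightarrow> 'c dg_ring \<Rightarrow> 'e dg_ring \<Rightarrow> ('a \<Rightarrow> 'c) \<Rightarrow> ('b \<Rightarrow> 'e) \<Rightarrow>
     ('a \<times> 'b \<Rightarrow>\<^sub>0 int) set \<Rightarrow> ('c \<times> 'e \<Rightarrow>\<^sub>0 int) set" where
  "tensor_map M N M' N' h k = (\<lambda>U \<in> carrier (tensor_dg M N).
     \<Union>u\<in>U. tensor_class M' N' (frag_extend (\<lambda>(x, y). frag_of (h x, k y)) u))"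


section \<open>Simplicial sets\<close>

text \<open>
  \<open>mono_maps p q\<close> is the set of nondecreasing functions \<open>[p] \<rightarrow> [q]\<close>, i.e. the morphisms of the
  simplex category, represented as functions that are \<open>undefined\<close> outside \<open>{..p}\<close>. A morphism
  \<open>f : [p] \<rightarrow> [q]\<close> acts on a simplicial set \<open>X\<close> as \<open>act X p q f : X\<^sub>q \<rightarrow> X\<^sub>p\<close>.
\<close>

definition mono_maps :: "nat \<Rightarrow> nat \<Rightarrow> (nat \<Rightarrow> nat) set" where
  "mono_maps p q = {f \<in> {..p} \<rightarrow>\<^sub>E {..q}. mono_on {..p} f}"

record 'x sset =
  simplices :: "nat \<Rightarrow> 'x set"
  act :: "nat \<Rightarrow> nat \<Rightarrow> (nat \<Rightarrow> nat) \<Rightarrow> 'x \<Rightarrow> 'x"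

locale simplicial_set =
  fixes X :: "'x sset"
  assumes act_closed: "\<lbrakk>f \<in> mono_maps p q; x \<in> simplices X q\<rbrakk> \<Longrightarrow> act X p q f x \<in> simplices X p"
    and act_id: "x \<in> simplices X p \<Longrightarrow> act X p p (\<lambda>i\<in>{..p}. i) x = x"
    and act_comp: "\<lbrakk>f \<in> mono_maps p q; g \<in> mono_maps q r; x \<in> simplices X r\<rbrakk> \<Longrightarrow>
        act X p r (compose {..p} g f) x = act X p q f (act X q r g x)"

definition sset_hom :: "'x sset \<Rightarrow> 'y sset \<Rightarrow> (nat \<Rightarrow> 'x \<Rightarrow> 'y) set" where
  "sset_hom X Y = {F. (\<forall>p. F p \<in> simplices X p \<rightarrow>\<^sub>E simplices Y p) \<and>
     (\<forall>p q. \<forall>f \<in> mono_maps p q. \<forall>x \<in> simplices X q.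
        F p (act X p q f x) = act Y p q f (F q x))}"

definition std_simplex :: "nat \<Rightarrow> (nat \<Rightarrow> nat) sset" where
  "std_simplex q = \<lparr>simplices = (\<lambda>p. mono_maps p q), act = (\<lambda>p r f s. compose {..p} s f)\<rparr>"

definition horn :: "nat \<Rightarrow> nat \<Rightarrow> (nat \<Rightarrow> nat) sset" where
  "horn q i = \<lparr>simplices = (\<lambda>p. {s \<in> mono_maps p q. s ` {..p} \<union> {i} \<noteq> {..q}}),
               act = act (std_simplex q)\<rparr>"

text \<open>The map \<open>\<Delta>\<^sup>p \<rightarrow> \<Delta>\<^sup>q\<close> induced by \<open>f : [p] \<rightarrow> [q]\<close>.\<close>

definition std_map :: "nat \<Rightarrow> (nat \<Rightarrow> nat) \<Rightarrow> nat \<Rightarrow> (nat \<Rightarrow> nat) \<Rightarrow> (nat \<Rightarrow> nat)" where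
  "std_map p f = (\<lambda>r. \<lambda>s \<in> mono_maps r p. compose {..r} f s)"

text \<open>The map \<open>\<Delta>\<^sup>p \<rightarrow> X\<close> corresponding to \<open>x \<in> X\<^sub>p\<close> (Yoneda).\<close>

definition simplex_map :: "'x sset \<Rightarrow> nat \<Rightarrow> 'x \<Rightarrow> nat \<Rightarrow> (nat \<Rightarrow> nat) \<Rightarrow> 'x" where
  "simplex_map X p x = (\<lambda>r. \<lambda>s \<in> mono_maps r p. act X r p s x)"

text \<open>\<open>face X p i : X\<^bsub>p+1\<^esub> \<rightarrow> X\<^sub>p\<close> and \<open>degen X p i : X\<^sub>p \<rightarrow> X\<^bsub>p+1\<^esub>\<close>.\<close>

definition face :: "'x sset \<Rightarrow> nat \<Rightarrow> nat \<Rightarrow> 'x \<Rightarrow> 'x" where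
  "face X p i = act X p (Suc p) (\<lambda>k\<in>{..p}. if k < i then k else Suc k)"

definition degen :: "'x sset \<Rightarrow> nat \<Rightarrow> nat \<Rightarrow> 'x \<Rightarrow> 'x" where
  "degen X p i = act X (Suc p) p (\<lambda>k\<in>{..Suc p}. if k \<le> i then k else k - 1)"

definition degenerate_simplices :: "'x sset \<Rightarrow> nat \<Rightarrow> 'x set" where
  "degenerate_simplices X n = {degen X p i y | p i y. n = Suc p \<and> i \<le> p \<and> y \<in> simplices X p}"

text \<open>For \<open>x \<in> X\<^bsub>p+q\<^esub>\<close>: the front \<open>p\<close>-face and the back \<open>q\<close>-face.\<close>

definition front_face :: "'x sset \<Rightarrow> nat \<Rightarrow> nat \<Rightarrow> 'x \<Rightarrow> 'x" where
  "front_face X p q = act X p (p + q) (\<lambda>k\<in>{..p}. k)"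

definition back_face :: "'x sset \<Rightarrow> nat \<Rightarrow> nat \<Rightarrow> 'x \<Rightarrow> 'x" where
  "back_face X p q = act X q (p + q) (\<lambda>k\<in>{..q}. p + k)"


section \<open>Normalized cochains\<close>

text \<open>
  An element of \<open>N(X, \<int>) = \<Oplus>\<^sub>p N\<^sup>p(X, \<int>)\<close> is the family of its components \<open>\<phi> p : X\<^sub>p \<rightarrow> \<int>\<close>,
  finitely many of which are nonzero; functions are extended by 0 outside \<open>X\<^sub>p\<close>.
\<close>

definition cochain_carrier :: "'x sset \<Rightarrow> (nat \<Rightarrow> 'x \<Rightarrow> int) set" where
  "cochain_carrier X = {\<phi>. finite {p. \<exists>x. \<phi> p x \<noteq> 0} \<and>
     (\<forall>p x. x \<notin> simplices X p \<or> x \<in> degenerate_simplices X p \<longrightarrow> \<phi> p x = 0)}"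

definition cochain_d :: "'x sset \<Rightarrow> (nat \<Rightarrow> 'x \<Rightarrow> int) \<Rightarrow> (nat \<Rightarrow> 'x \<Rightarrow> int)" where
  "cochain_d X \<phi> = (\<lambda>n x. case n of 0 \<Rightarrow> 0
     | Suc p \<Rightarrow> if x \<in> simplices X (Suc p)
               then \<Sum>i\<le>Suc p. (-1) ^ i * \<phi> p (face X p i x) else 0)"

definition cochain_mult ::
    "'x sset \<Rightarrow> (nat \<Rightarrow> 'x \<Rightarrow> int) \<Rightarrow> (nat \<Rightarrow> 'x \<Rightarrow> int) \<Rightarrow> (nat \<Rightarrow> 'x \<Rightarrow> int)" where
  "cochain_mult X \<phi> \<psi> = (\<lambda>n x. if x \<in> simplices X n
     then \<Sum>p\<le>n. \<phi> p (front_face X p (n - p) x) * \<psi> (n - p) (back_face X p (n - p) x) else 0)"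

definition cochains :: "'x sset \<Rightarrow> (nat \<Rightarrow> 'x \<Rightarrow> int) dg_ring" where
  "cochains X = \<lparr>
     carrier = cochain_carrier X,
     mult = cochain_mult X,
     one = (\<lambda>p x. if p = 0 \<and> x \<in> simplices X 0 then 1 else 0),
     zero = (\<lambda>p x. 0),
     add = (\<lambda>\<phi> \<psi> p x. \<phi> p x + \<psi> p x),
     dg_part = (\<lambda>n. {\<phi> \<in> cochain_carrier X. \<forall>p x. int p \<noteq> n \<longrightarrow> \<phi> p x = 0}),
     dg_d = cochain_d X\<rparr>"

text \<open>The homomorphism \<open>N(Y, \<int>) \<rightarrow> N(X, \<int>)\<close> induced by \<open>F : X \<rightarrow> Y\<close>.\<close>

definition cochain_pullback ::
    "'x sset \<Rightarrow> (nat \<Rightarrow> 'x \<Rightarrow> 'y) \<Rightarrow> (nat \<Rightarrow> 'y \<Rightarrow> int) \<Rightarrow> (nat \<Rightarrow> 'x \<Rightarrow> int)" where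
  "cochain_pullback X F \<phi> = (\<lambda>p x. if x \<in> simplices X p then \<phi> p (F p x) else 0)"

type_synonym ('x, 'b) ncoch = "((nat \<Rightarrow> 'x \<Rightarrow> int) \<times> 'b \<Rightarrow>\<^sub>0 int) set"

definition NC :: "'x sset \<Rightarrow> 'b dg_ring \<Rightarrow> ('x, 'b) ncoch dg_ring" where
  "NC X B = tensor_dg (cochains X) B"

text \<open>The homomorphism \<open>N(F, B) : N(Y, B) \<rightarrow> N(X, B)\<close> induced by \<open>F : X \<rightarrow> Y\<close>.\<close>

definition NC_map ::
    "'x sset \<Rightarrow> 'y sset \<Rightarrow> 'b dg_ring \<Rightarrow> (nat \<Rightarrow> 'x \<Rightarrow> 'y) \<Rightarrow> ('y, 'b) ncoch \<Rightarrow> ('x, 'b) ncoch" where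
  "NC_map X Y B F = tensor_map (cochains Y) B (cochains X) B (cochain_pullback X F) id"

definition Cyl :: "nat \<Rightarrow> 'b dg_ring \<Rightarrow> (nat \<Rightarrow> nat, 'b) ncoch dg_ring" where
  "Cyl q B = NC (std_simplex q) B"

definition SHom :: "'a dg_ring \<Rightarrow> 'b dg_ring \<Rightarrow> ('a \<Rightarrow> (nat \<Rightarrow> nat, 'b) ncoch) sset" where
  "SHom A B = \<lparr>simplices = (\<lambda>q. dg_hom A (Cyl q B)),
     act = (\<lambda>p q f h. compose (carrier A)
              (NC_map (std_simplex p) (std_simplex q) B (std_map p f)) h)\<rparr>"

text \<open>
  The canonical map \<open>Hom(A, N(X, B)) \<rightarrow> Hom(X, SHom(A, B))\<close>: a homomorphism \<open>h\<close> is sent to the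
  map of simplicial sets \<open>x \<mapsto> N(x, B) \<circ> h\<close>, where a simplex \<open>x \<in> X\<^sub>p\<close> is viewed as a
  map \<open>\<Delta>\<^sup>p \<rightarrow> X\<close>.
\<close>

definition canonical_map ::
    "'x sset \<Rightarrow> 'a dg_ring \<Rightarrow> 'b dg_ring \<Rightarrow> ('a \<Rightarrow> ('x, 'b) ncoch) \<Rightarrow>
     nat \<Rightarrow> 'x \<Rightarrow> 'a \<Rightarrow> (nat \<Rightarrow> nat, 'b) ncoch" where
  "canonical_map X A B h = (\<lambda>p. \<lambda>x \<in> simplices X p.
     compose (carrier A) (NC_map (std_simplex p) X B (simplex_map X p x)) h)"


section \<open>Standard simplices and horns are simplicial sets\<close>

lemma mono_maps_compose:
  assumes "f \<in> mono_maps p q" "g \<in> mono_maps q r"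
  shows "compose {..p} g f \<in> mono_maps p r"
proof -
  have f: "f \<in> {..p} \<rightarrow> {..q}" "mono_on {..p} f" and g: "g \<in> {..q} \<rightarrow> {..r}" "mono_on {..q} g"
    using assms by (auto simp: mono_maps_def)
  have "mono_on {..p} (compose {..p} g f)"
  proof (rule mono_onI)
    fix a b assume ab: "a \<in> {..p}" "b \<in> {..p}" "a \<le> b"
    then have "f a \<le> f b" "f a \<in> {..q}" "f b \<in> {..q}"
      using f by (auto simp: monotone_on_def)
    then have "g (f a) \<le> g (f b)" using g by (auto simp: monotone_on_def)
    then show "compose {..p} g f a \<le> compose {..p} g f b" using ab by (simp add: compose_def)
  qed
  moreover have "compose {..p} g f \<in> {..p} \<rightarrow>\<^sub>E {..r}"
    using f(1) g(1) by (auto simp: compose_def)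
  ultimately show ?thesis by (simp add: mono_maps_def)
qed

lemma mono_maps_compose_id:
  "s \<in> mono_maps p q \<Longrightarrow> compose {..p} s (\<lambda>i\<in>{..p}. i) = s"
  by (auto simp: mono_maps_def compose_def fun_eq_iff PiE_def extensional_def)

lemma mono_maps_compose_assoc:
  "f \<in> mono_maps p q \<Longrightarrow>
   compose {..p} s (compose {..p} g f) = compose {..p} (compose {..q} s g) f"
  by (auto simp: mono_maps_def compose_def fun_eq_iff)

lemma simplicial_set_std_simplex: "simplicial_set (std_simplex q)"
  by unfold_locales
    (auto simp: std_simplex_def mono_maps_compose mono_maps_compose_id mono_maps_compose_assoc)

lemma simplicial_set_horn:
  assumes "i \<le> q"
  shows "simplicial_set (horn q i)"
proof unfold_locales
  fix f p r s
  assume f: "f \<in> mono_maps p r" and s: "s \<in> simplices (horn q i) r"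
  have "compose {..p} s f ` {..p} \<subseteq> s ` {..r}"
    using f by (auto simp: mono_maps_def compose_def)
  moreover have "s ` {..r} \<union> {i} \<subseteq> {..q}"
    using s assms by (auto simp: horn_def mono_maps_def)
  moreover have "s ` {..r} \<union> {i} \<noteq> {..q}" "s \<in> mono_maps r q"
    using s by (auto simp: horn_def)
  ultimately have "compose {..p} s f ` {..p} \<union> {i} \<noteq> {..q}"
    by blast
  then show "act (horn q i) p r f s \<in> simplices (horn q i) p"
    using f \<open>s \<in> mono_maps r q\<close> mono_maps_compose[of f p r s q]
    by (simp add: horn_def std_simplex_def)
qed (auto simp: horn_def std_simplex_def mono_maps_compose_id mono_maps_compose_assoc)

end

theory Submission
  imports Defs
begin

text \<open>
  A cochain on a simplicial set \<open>X\<close> with finitely many nondegenerate simplices is a finite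
  combination of the indicators of those simplices. Hence \<open>U \<in> N(X, B)\<close> is determined by its values
  \<open>U(x) \<in> B\<close>, \<open>x \<in> X\<^sub>p\<close>, and every family of values vanishing on degenerate simplices occurs.
  Pulling \<open>U\<close> back along the map \<open>\<Delta>\<^sup>p \<rightarrow> X\<close> of a simplex \<open>x\<close> gives the element of
  \<open>N(\<Delta>\<^sup>p, B)\<close> whose value at \<open>s \<in> \<Delta>\<^sup>p\<^sub>r\<close> is \<open>U(s\<^sup>*x)\<close>; in particular \<open>U(x)\<close> is its
  value at the top simplex \<open>id\<close>. So these pullbacks are jointly injective DG ring homomorphisms,
  and a simplicial map \<open>\<Psi> : X \<rightarrow> SHom(A, B)\<close> comes from exactly one
  \<open>h : A \<rightarrow> N(X, B)\<close>, namely \<open>h(a)(x) = \<Psi>(x)(a)(id)\<close>. That \<open>h\<close> is a homomorphism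
  is checked after pulling back to each simplex.
\<close>

section \<open>Homogeneous components\<close>

text \<open>Elements of \<open>tensor_dg\<close> are cosets in a free group, so nothing about
  \<open>N(X, B)\<close> can be read off directly: each operation is shown to respect the relations
  and is then computed on representatives. Evaluation at \<open>x\<close> is the additive map
  induced by \<open>\<phi> \<otimes> b \<mapsto> \<phi>(x) b\<close>. Finiteness is what makes every
  family of values occur: a tensor is a finite sum of terms \<open>\<phi> \<otimes> b\<close>, so
  its values span a finitely generated subgroup of \<open>B\<close> and vanish in large dimensions,
  which a family of values on an infinite \<open>X\<close> need not do. A nondegenerate simplex of a
  subcomplex of \<open>\<Delta>^q\<close> is strictly increasing, hence of dimension at most
  \<open>q\<close>; this covers horns. Evaluation is additive but not multiplicative. Identities for
  \<open>h\<close> are therefore transported along the pullbacks to simplices, which respect all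
  operations, instead of being compared value by value. Membership in a graded part is not an
  identity, but it is visible on values: at a \<open>p\<close>-simplex, an element of degree
  \<open>n\<close> has a value of degree \<open>n - p\<close>.\<close>

text \<open>
  The part of the structure of a DG ring that the construction of the tensor product depends on;
  it spares the verification of associativity and of the Leibniz rule for cochains.
\<close>

locale weak_dg_ring = abelian_group A for A :: "'a dg_ring" (structure) +
  assumes one_closed: "\<one> \<in> carrier A"
    and mult_closed: "\<lbrakk>x \<in> carrier A; y \<in> carrier A\<rbrakk> \<Longrightarrow> x \<otimes> y \<in> carrier A"
    and distr_left: "\<lbrakk>x \<in> carrier A; y \<in> carrier A; z \<in> carrier A\<rbrakk> \<Longrightarrow> (x \<oplus> y) \<otimes> z = x \<otimes> z \<oplus> y \<otimes> z"
    and distr_right: "\<lbrakk>x \<in> carrier A; y \<in> carrier A; z \<in> carrier A\<rbrakk> \<Longrightarrow> z \<otimes> (x \<oplus> y) = z \<otimes> x \<oplus> z \<otimes> y"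
    and part_subgroup: "additive_subgroup (dg_part A i) A"
    and direct_sum: "x \<in> carrier A \<Longrightarrow> \<exists>!c. homogeneous_decomp A x c"
    and d_closed: "x \<in> carrier A \<Longrightarrow> dg_d A x \<in> carrier A"
    and d_add: "\<lbrakk>x \<in> carrier A; y \<in> carrier A\<rbrakk> \<Longrightarrow> dg_d A (x \<oplus> y) = dg_d A x \<oplus> dg_d A y"

sublocale dg_ring \<subseteq> weak_dg_ring
  by (intro weak_dg_ring.intro weak_dg_ring_axioms.intro is_abelian_group)
    (simp_all add: l_distr r_distr part_subgroup direct_sum d_closed d_add)

context weak_dg_ring
begin

lemma mult_zero_left: "x \<in> carrier A \<Longrightarrow> \<zero> \<otimes> x = \<zero>"
  using distr_left[of \<zero> \<zero> x] mult_closed[of \<zero> x] by (simp add: add.l_cancel_one')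

lemma mult_zero_right: "x \<in> carrier A \<Longrightarrow> x \<otimes> \<zero> = \<zero>"
  using distr_right[of \<zero> \<zero> x] mult_closed[of x \<zero>] by (simp add: add.l_cancel_one')

lemma part_closed: "x \<in> dg_part A i \<Longrightarrow> x \<in> carrier A"
  using additive_subgroup.a_subset[OF part_subgroup] by blast

text \<open>\<open>homogeneous_decomp\<close> sums over the exact support, which is hard to control
  for sums and images. Any finite \<open>T\<close> containing the support works, since the extra
  terms are zero.\<close>

lemma homogeneous_decompI:
  assumes "finite T" "\<And>i. c i \<in> dg_part A i" "\<And>i. i \<notin> T \<Longrightarrow> c i = \<zero>" "x = finsum A c T"
  shows "homogeneous_decomp A x c"
proof -
  have "{i. c i \<noteq> \<zero>} \<subseteq> T" using assms(3) by blast
  moreover have "finsum A c T = finsum A c {i. c i \<noteq> \<zero>}"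
    by (rule add.finprod_mono_neutral_cong_right)
      (use assms calculation part_closed in \<open>auto simp: Pi_iff intro: part_closed\<close>)
  ultimately show ?thesis
    using assms finite_subset unfolding homogeneous_decomp_def by auto
qed

lemma homogeneous_decomp_finsum:
  assumes "homogeneous_decomp A x c" "finite T" "\<And>i. i \<notin> T \<Longrightarrow> c i = \<zero>"
  shows "x = finsum A c T"
proof -
  have "{i. c i \<noteq> \<zero>} \<subseteq> T" using assms(3) by blast
  moreover have "finsum A c T = finsum A c {i. c i \<noteq> \<zero>}"
    by (rule add.finprod_mono_neutral_cong_right)
      (use assms calculation in \<open>auto simp: homogeneous_decomp_def Pi_iff intro: part_closed\<close>)
  ultimately show ?thesis
    using assms by (simp add: homogeneous_decomp_def)
qed

lemma homogeneous_decomp_comp: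
  assumes "x \<in> carrier A"
  shows "homogeneous_decomp A x (\<lambda>i. dg_comp A i x)"
  unfolding dg_comp_def using theI'[OF direct_sum[OF assms]] by simp

lemma comp_unique:
  assumes "x \<in> carrier A" "homogeneous_decomp A x c"
  shows "dg_comp A i x = c i"
  unfolding dg_comp_def using the1_equality[OF direct_sum] assms by metis

lemma comp_part: "x \<in> carrier A \<Longrightarrow> dg_comp A i x \<in> dg_part A i"
  using homogeneous_decomp_comp unfolding homogeneous_decomp_def by blast

lemma comp_closed: "x \<in> carrier A \<Longrightarrow> dg_comp A i x \<in> carrier A"
  using comp_part part_closed by blast

lemma finite_supp: "x \<in> carrier A \<Longrightarrow> finite (dg_supp A x)"
  using homogeneous_decomp_comp unfolding homogeneous_decomp_def dg_supp_def by blast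

text \<open>The images of the components of \<open>x\<close> again form a homogeneous decomposition,
  and decompositions are unique. Some images may vanish, which \<open>homogeneous_decompI\<close>
  tolerates.\<close>

lemma comp_hom:
  assumes B: "weak_dg_ring B" and x: "x \<in> carrier A"
    and h: "h \<in> carrier A \<rightarrow> carrier B"
    and h_add: "\<And>x y. \<lbrakk>x \<in> carrier A; y \<in> carrier A\<rbrakk> \<Longrightarrow> h (x \<oplus> y) = h x \<oplus>\<^bsub>B\<^esub> h y"
    and h_part: "\<And>i x. x \<in> dg_part A i \<Longrightarrow> h x \<in> dg_part B i"
  shows "dg_comp B i (h x) = h (dg_comp A i x)"
proof -
  interpret B: weak_dg_ring B by fact
  have "h \<zero> \<in> carrier B" using h by blast
  then have h0: "h \<zero> = \<zero>\<^bsub>B\<^esub>"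
    using h_add[of \<zero> \<zero>] by (simp add: B.add.l_cancel_one')
  have sum: "h (finsum A c T) = finsum B (\<lambda>i. h (c i)) T"
    if "finite T" "\<And>i. c i \<in> carrier A" for c :: "int \<Rightarrow> 'a" and T
    using that(1)
  proof (induction T)
    case (insert i T)
    then show ?case
      using h that(2) by (simp add: h_add Pi_iff)
  qed (simp add: h0)
  have "homogeneous_decomp B (h x) (\<lambda>i. h (dg_comp A i x))"
  proof (rule B.homogeneous_decompI)
    have "x = finsum A (\<lambda>i. dg_comp A i x) (dg_supp A x)"
      using homogeneous_decomp_finsum[OF homogeneous_decomp_comp[OF x] finite_supp[OF x]]
      by (simp add: dg_supp_def)
    then show "h x = finsum B (\<lambda>i. h (dg_comp A i x)) (dg_supp A x)"
      using sum[of "dg_supp A x" "\<lambda>i. dg_comp A i x"] finite_supp[OF x] comp_closed[OF x] by simp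
  qed (use x finite_supp comp_part h_part h0 in \<open>auto simp: dg_supp_def\<close>)
  then show ?thesis
    using B.comp_unique h x by blast
qed

text \<open>Makes the Koszul formulas, which split their arguments into components, compatible with
  the biadditivity relations. Both decompositions are first written over the union of the two
  supports.\<close>

lemma comp_add:
  assumes "x \<in> carrier A" "y \<in> carrier A"
  shows "dg_comp A i (x \<oplus> y) = dg_comp A i x \<oplus> dg_comp A i y"
proof (rule comp_unique)
  let ?T = "dg_supp A x \<union> dg_supp A y"
  show "homogeneous_decomp A (x \<oplus> y) (\<lambda>i. dg_comp A i x \<oplus> dg_comp A i y)"
  proof (rule homogeneous_decompI[where T = ?T])
    have "x = finsum A (\<lambda>i. dg_comp A i x) ?T" "y = finsum A (\<lambda>i. dg_comp A i y) ?T"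
      by (rule homogeneous_decomp_finsum[OF homogeneous_decomp_comp];
          use assms finite_supp in \<open>auto simp: dg_supp_def\<close>)+
    then show "x \<oplus> y = (\<Oplus>i\<in>?T. dg_comp A i x \<oplus> dg_comp A i y)"
      using assms comp_closed by (subst add.finprod_multf) (auto intro!: arg_cong2[where f = "(\<oplus>)"])
  qed (use assms finite_supp comp_part additive_subgroup.a_closed[OF part_subgroup]
        in \<open>auto simp: dg_supp_def\<close>)
qed (use assms in simp)

end

section \<open>The tensor product\<close>

lemma add_diff_add_eq: "u - v + (u' - v') = u + u' - (v + v')" for u v u' v' :: "'c \<Rightarrow>\<^sub>0 int"
  by simp

lemma diff_diff_diff_eq: "u - v - (u' - v') = u - u' - (v - v')" for u v u' v' :: "'c \<Rightarrow>\<^sub>0 int"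
  by simp

lemma frag_cmul_diff: "frag_cmul k (u - v) = frag_cmul k u - frag_cmul k v"
  by (rule poly_mapping_eqI) (simp add: lookup_minus right_diff_distrib)

lemma frag_extend_fun_diff:
  "frag_extend (\<lambda>g. f g - f' g) u = frag_extend f u - frag_extend f' u"
  unfolding frag_extend_def sum_subtractf[symmetric]
  by (simp add: frag_cmul_diff)

section \<open>Calculus modulo the biadditivity relations\<close>

definition tensor_cong ::
    "'a dg_ring \<Rightarrow> 'b dg_ring \<Rightarrow> ('a \<times> 'b \<Rightarrow>\<^sub>0 int) \<Rightarrow> ('a \<times> 'b \<Rightarrow>\<^sub>0 int) \<Rightarrow> bool" where
  "tensor_cong M N u v \<longleftrightarrow> u - v \<in> tensor_rel M N"

locale abelian_group_pair = M: abelian_group M + N: abelian_group N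
  for M :: "'a dg_ring" and N :: "'b dg_ring"
begin

abbreviation F :: "('a \<times> 'b \<Rightarrow>\<^sub>0 int) set" where "F \<equiv> carrier (tensor_free M N)"
abbreviation R :: "('a \<times> 'b \<Rightarrow>\<^sub>0 int) set" where "R \<equiv> tensor_rel M N"
abbreviation cong (infix "\<sim>" 50) where "u \<sim> v \<equiv> tensor_cong M N u v"

sublocale F: comm_group "tensor_free M N"
  by (rule abelian_free_Abelian_group)

lemma F_add: "u \<in> F \<Longrightarrow> v \<in> F \<Longrightarrow> u + v \<in> F"
  using F.m_closed by simp

lemma F_minus: "u \<in> F \<Longrightarrow> - u \<in> F"
  by simp

lemma F_diff: "u \<in> F \<Longrightarrow> v \<in> F \<Longrightarrow> u - v \<in> F"
  using keys_diff[of u v] by auto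

lemma F_cmul: "u \<in> F \<Longrightarrow> frag_cmul k u \<in> F"
  using keys_cmul[of k u] by auto

text \<open>The target index set \<open>T\<close> is arbitrary, so that this serves operations
  within one tensor product as well as maps into another one.\<close>

lemma F_extend:
  assumes "u \<in> F" and f: "\<And>g. g \<in> carrier M \<times> carrier N \<Longrightarrow> f g \<in> carrier (free_Abelian_group T)"
  shows "frag_extend f u \<in> carrier (free_Abelian_group T)"
proof -
  have "(\<Union>g\<in>Poly_Mapping.keys u. Poly_Mapping.keys (f g)) \<subseteq> T"
  proof (rule UN_least)
    fix g assume "g \<in> Poly_Mapping.keys u"
    then have "g \<in> carrier M \<times> carrier N"
      using assms(1)[unfolded carrier_free_Abelian_group_iff] by (rule subsetD[rotated])
    then show "Poly_Mapping.keys (f g) \<subseteq> T"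
      by (rule f[unfolded carrier_free_Abelian_group_iff])
  qed
  then show ?thesis
    by (simp only: carrier_free_Abelian_group_iff subset_trans[OF keys_frag_extend])
qed

lemma tensor_rel_generators: "{frag_of (x \<oplus>\<^bsub>M\<^esub> x', y) - frag_of (x, y) - frag_of (x', y) | x x' y.
         x \<in> carrier M \<and> x' \<in> carrier M \<and> y \<in> carrier N} \<union>
      {frag_of (x, y \<oplus>\<^bsub>N\<^esub> y') - frag_of (x, y) - frag_of (x, y') | x y y'.
         x \<in> carrier M \<and> y \<in> carrier N \<and> y' \<in> carrier N} \<subseteq> F"
  by (auto intro!: F_diff simp del: carrier_free_Abelian_group_iff)

lemma subgroup_rel: "subgroup R (tensor_free M N)"
  unfolding tensor_rel_def by (rule F.generate_is_subgroup[OF tensor_rel_generators])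

text \<open>\<open>R\<close> is the least subgroup containing the generating relations. The intended
  \<open>H\<close> are the kernel of an evaluation and the preimage of the relations of another
  tensor product.\<close>

lemma rel_subsetI:
  assumes "subgroup H (tensor_free M N)"
    and "\<And>x x' y. \<lbrakk>x \<in> carrier M; x' \<in> carrier M; y \<in> carrier N\<rbrakk> \<Longrightarrow>
      frag_of (x \<oplus>\<^bsub>M\<^esub> x', y) - frag_of (x, y) - frag_of (x', y) \<in> H"
    and "\<And>x y y'. \<lbrakk>x \<in> carrier M; y \<in> carrier N; y' \<in> carrier N\<rbrakk> \<Longrightarrow>
      frag_of (x, y \<oplus>\<^bsub>N\<^esub> y') - frag_of (x, y) - frag_of (x, y') \<in> H"
  shows "R \<subseteq> H"
  unfolding tensor_rel_def by (rule F.generate_subgroup_incl[OF _ assms(1)]) (use assms(2,3) in blast)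

lemma rel_F: "u \<in> R \<Longrightarrow> u \<in> F"
  using subgroup.subset[OF subgroup_rel] by blast

lemma rel_zero: "0 \<in> R"
  using subgroup.one_closed[OF subgroup_rel] by simp

lemma rel_add: "u \<in> R \<Longrightarrow> v \<in> R \<Longrightarrow> u + v \<in> R"
  using subgroup.m_closed[OF subgroup_rel] by simp

lemma rel_minus: "u \<in> R \<Longrightarrow> - u \<in> R"
  using subgroup.m_inv_closed[OF subgroup_rel] rel_F by (metis carrier_free_Abelian_group_iff inv_free_Abelian_group)

lemma rel_diff: "u \<in> R \<Longrightarrow> v \<in> R \<Longrightarrow> u - v \<in> R"
  using rel_add[of u "- v"] rel_minus by simp

lemma rel_cmul: "u \<in> R \<Longrightarrow> frag_cmul k u \<in> R"
  by (rule frag_closure_minus_cmul[where P = "\<lambda>u. u \<in> R"]) (auto intro: rel_zero rel_diff)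

lemma rel_sum: "(\<And>i. i \<in> I \<Longrightarrow> f i \<in> R) \<Longrightarrow> sum f I \<in> R"
  by (induction I rule: infinite_finite_induct) (auto intro: rel_zero rel_add)

lemma rel_extend: "(\<And>g. g \<in> Poly_Mapping.keys u \<Longrightarrow> f g \<in> R) \<Longrightarrow> frag_extend f u \<in> R"
  unfolding frag_extend_def by (intro rel_sum rel_cmul)

lemma cong_refl: "u \<sim> u"
  by (simp add: tensor_cong_def rel_zero)

lemma cong_sym: "u \<sim> v \<Longrightarrow> v \<sim> u"
  unfolding tensor_cong_def using rel_minus[of "u - v"] by (simp only: minus_diff_eq)

lemma cong_trans [trans]: "u \<sim> v \<Longrightarrow> v \<sim> w \<Longrightarrow> u \<sim> w"
  unfolding tensor_cong_def using rel_add[of "u - v" "v - w"] by (simp only: diff_add_cancel add_diff_eq)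

lemma cong_add: "u \<sim> v \<Longrightarrow> u' \<sim> v' \<Longrightarrow> u + u' \<sim> v + v'"
  unfolding tensor_cong_def using rel_add[of "u - v" "u' - v'"]
  by (simp only: add_diff_add_eq)

lemma cong_diff: "u \<sim> v \<Longrightarrow> u' \<sim> v' \<Longrightarrow> u - u' \<sim> v - v'"
  unfolding tensor_cong_def using rel_diff[of "u - v" "u' - v'"]
  by (simp only: diff_diff_diff_eq)

lemma cong_cmul: "u \<sim> v \<Longrightarrow> frag_cmul k u \<sim> frag_cmul k v"
  unfolding tensor_cong_def using rel_cmul[of "u - v" k] by (simp only: frag_cmul_diff)

lemma cong_sum: "(\<And>i. i \<in> I \<Longrightarrow> f i \<sim> g i) \<Longrightarrow> sum f I \<sim> sum g I"
  unfolding tensor_cong_def sum_subtractf[symmetric] by (rule rel_sum)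

text \<open>Product and differential sum over supports, which vary with the argument; this enlarges
  them to a common set. Equality would fail: \<open>frag_of (\<zero>, y)\<close> is nonzero in the
  free group and vanishes only modulo the relations.\<close>

lemma cong_sum_neutral:
  assumes "finite T" "S \<subseteq> T" "\<And>i. i \<in> T - S \<Longrightarrow> f i \<sim> 0"
  shows "sum f S \<sim> sum f T"
proof -
  have 0: "sum f (T - S) \<sim> 0" using cong_sum[of "T - S" f "\<lambda>_. 0"] assms(3) by simp
  have eq: "sum f T = sum f (T - S) + sum f S"
    using assms(1,2) by (rule sum.subset_diff[rotated])
  have "sum f T \<sim> 0 + sum f S"
    unfolding eq by (rule cong_add[OF 0 cong_refl])
  then show ?thesis
    by (simp add: cong_sym)
qed

lemma cong_zero_iff: "u \<sim> 0 \<longleftrightarrow> u \<in> R"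
  by (simp add: tensor_cong_def)

lemma cong_left: "\<lbrakk>x \<in> carrier M; x' \<in> carrier M; y \<in> carrier N\<rbrakk> \<Longrightarrow>
    frag_of (x \<oplus>\<^bsub>M\<^esub> x', y) \<sim> frag_of (x, y) + frag_of (x', y)"
  unfolding tensor_cong_def tensor_rel_def diff_diff_eq[symmetric]
  by (rule generate.incl) blast

lemma cong_right: "\<lbrakk>x \<in> carrier M; y \<in> carrier N; y' \<in> carrier N\<rbrakk> \<Longrightarrow>
    frag_of (x, y \<oplus>\<^bsub>N\<^esub> y') \<sim> frag_of (x, y) + frag_of (x, y')"
  unfolding tensor_cong_def tensor_rel_def diff_diff_eq[symmetric]
  by (rule generate.incl) blast

section \<open>Maps to the free group that are additive modulo the relations\<close>

lemma additive_cong_zero: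
  assumes "abelian_group C" and f: "\<And>x y. \<lbrakk>x \<in> carrier C; y \<in> carrier C\<rbrakk> \<Longrightarrow> f (x \<oplus>\<^bsub>C\<^esub> y) \<sim> f x + f y"
  shows "f \<zero>\<^bsub>C\<^esub> \<sim> 0"
proof -
  interpret C: abelian_group C by fact
  show ?thesis
    using cong_diff[OF cong_sym[OF f] cong_refl[of "f \<zero>\<^bsub>C\<^esub>"], of "\<zero>\<^bsub>C\<^esub>" "\<zero>\<^bsub>C\<^esub>"] by simp
qed

lemma additive_cong_finsum:
  assumes "abelian_group C" and f: "\<And>x y. \<lbrakk>x \<in> carrier C; y \<in> carrier C\<rbrakk> \<Longrightarrow> f (x \<oplus>\<^bsub>C\<^esub> y) \<sim> f x + f y"
    and "finite I" "c \<in> I \<rightarrow> carrier C"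
  shows "f (finsum C c I) \<sim> (\<Sum>i\<in>I. f (c i))"
proof -
  interpret C: abelian_group C by fact
  show ?thesis using assms(3,4)
  proof (induction I)
    case empty
    then show ?case using additive_cong_zero[OF assms(1,2)] by simp
  next
    case (insert i I)
    then show ?case
      using cong_trans[OF f[of "c i" "finsum C c I"] cong_add[OF cong_refl insert.IH]] by simp
  qed
qed

text \<open>Yields balancedness: integers pass through either tensor factor, although only
  biadditivity is imposed. For \<open>k \<ge> 0\<close> this is induction; for \<open>k < 0\<close>
  the values at the multiples by \<open>k\<close> and \<open>- k\<close> add up to zero modulo the
  relations.\<close>

lemma additive_cong_int:
  fixes k :: int
  assumes "abelian_group C" and f: "\<And>x y. \<lbrakk>x \<in> carrier C; y \<in> carrier C\<rbrakk> \<Longrightarrow> f (x \<oplus>\<^bsub>C\<^esub> y) \<sim> f x + f y"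
    and x: "x \<in> carrier C"
  shows "f ([k] \<cdot>\<^bsub>C\<^esub> x) \<sim> frag_cmul k (f x)"
proof -
  interpret C: abelian_group C by fact
  have *: "f ([int n] \<cdot>\<^bsub>C\<^esub> x) \<sim> frag_cmul (int n) (f x)" for n
  proof (induction n)
    case 0
    then show ?case using additive_cong_zero[OF assms(1,2)] by (simp add: add_pow_def)
  next
    case (Suc n)
    have "[int (Suc n)] \<cdot>\<^bsub>C\<^esub> x = [int n] \<cdot>\<^bsub>C\<^esub> x \<oplus>\<^bsub>C\<^esub> x"
      using C.add.int_pow_mult[OF x, of "int n" 1] x by (simp add: add.commute C.add.int_pow_1)
    then show ?case
      using cong_trans[OF f cong_add[OF Suc.IH cong_refl[of "f x"]]] x
      by (simp add: C.add.int_pow_closed frag_cmul_distrib add.commute)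
  qed
  show ?thesis
  proof (cases "k \<ge> 0")
    case True
    then show ?thesis using *[of "nat k"] by simp
  next
    case False
    have c: "[k] \<cdot>\<^bsub>C\<^esub> x \<in> carrier C" "[(- k)] \<cdot>\<^bsub>C\<^esub> x \<in> carrier C"
      using x by (simp_all add: C.add.int_pow_closed)
    have "[k] \<cdot>\<^bsub>C\<^esub> x \<oplus>\<^bsub>C\<^esub> [(- k)] \<cdot>\<^bsub>C\<^esub> x = \<zero>\<^bsub>C\<^esub>"
      using C.add.int_pow_mult[OF x, of k "- k"] by (simp add: add_pow_def)
    then have "f ([k] \<cdot>\<^bsub>C\<^esub> x) + f ([(- k)] \<cdot>\<^bsub>C\<^esub> x) \<sim> 0"
      using cong_trans[OF cong_sym[OF f[OF c]]] additive_cong_zero[of C f] f assms(1) by simp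
    then have "f ([k] \<cdot>\<^bsub>C\<^esub> x) + f ([(- k)] \<cdot>\<^bsub>C\<^esub> x) - f ([(- k)] \<cdot>\<^bsub>C\<^esub> x) \<sim> 0 - frag_cmul (- k) (f x)"
      using *[of "nat (- k)"] False by (intro cong_diff) auto
    then show ?thesis by simp
  qed
qed

lemma additive_cong_diff:
  assumes "abelian_group C" and f: "\<And>x y. \<lbrakk>x \<in> carrier C; y \<in> carrier C\<rbrakk> \<Longrightarrow> f (x \<oplus>\<^bsub>C\<^esub> y) \<sim> f x + f y"
    and x: "x \<in> carrier C" and y: "y \<in> carrier C"
  shows "f (x \<ominus>\<^bsub>C\<^esub> y) \<sim> f x - f y"
proof -
  interpret C: abelian_group C by fact
  have "x \<ominus>\<^bsub>C\<^esub> y \<oplus>\<^bsub>C\<^esub> y = x"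
    using x y by (simp add: a_minus_def C.a_assoc C.l_neg)
  then have "f x \<sim> f (x \<ominus>\<^bsub>C\<^esub> y) + f y"
    using f[of "x \<ominus>\<^bsub>C\<^esub> y" y] x y by simp
  then have "f x - f y \<sim> f (x \<ominus>\<^bsub>C\<^esub> y) + f y - f y"
    by (rule cong_diff[OF _ cong_refl])
  then show ?thesis by (simp add: cong_sym)
qed

text \<open>Criterion for a map given on pairs to descend to tensor products. The elements sent into
  the target relations form a subgroup, so it is enough to treat the biadditivity
  generators.\<close>

lemma extend_rel:
  assumes "abelian_group_pair M' N'"
    and left: "\<And>x x' y. \<lbrakk>x \<in> carrier M; x' \<in> carrier M; y \<in> carrier N\<rbrakk> \<Longrightarrow>
      tensor_cong M' N' (f (x \<oplus>\<^bsub>M\<^esub> x', y)) (f (x, y) + f (x', y))"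
    and right: "\<And>x y y'. \<lbrakk>x \<in> carrier M; y \<in> carrier N; y' \<in> carrier N\<rbrakk> \<Longrightarrow>
      tensor_cong M' N' (f (x, y \<oplus>\<^bsub>N\<^esub> y')) (f (x, y) + f (x, y'))"
    and "u \<in> R"
  shows "frag_extend f u \<in> tensor_rel M' N'"
proof -
  interpret P: abelian_group_pair M' N' by fact
  let ?H = "{u \<in> F. frag_extend f u \<in> P.R}"
  have "R \<subseteq> ?H"
  proof (rule rel_subsetI)
    show "subgroup ?H (tensor_free M N)"
    proof (rule F.subgroupI)
      have "0 \<in> ?H" by (simp add: P.rel_zero)
      then show "?H \<noteq> {}" by blast
      show "inv\<^bsub>tensor_free M N\<^esub> a \<in> ?H" if "a \<in> ?H" for a
        using that by (auto simp: frag_extend_minus P.rel_minus)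
      show "a \<otimes>\<^bsub>tensor_free M N\<^esub> b \<in> ?H" if "a \<in> ?H" "b \<in> ?H" for a b
        using that F_add[of a b] by (simp add: frag_extend_add P.rel_add)
    qed auto
  qed (use left right in \<open>auto intro!: F_diff F_add simp: tensor_cong_def frag_extend_diff frag_extend_add diff_diff_eq
        simp del: carrier_free_Abelian_group_iff\<close>)
  then show ?thesis using assms(4) by blast
qed

section \<open>Cosets and the additive structure of the tensor product\<close>

lemma class_eq_Collect: "tensor_class M N u = {v. v \<sim> u}"
proof -
  have "v \<in> tensor_class M N u \<longleftrightarrow> v - u \<in> R" for v
  proof
    assume "v \<in> tensor_class M N u"
    then obtain r where "r \<in> R" "v = r + u"
      by (auto simp: tensor_class_def r_coset_def)
    then show "v - u \<in> R" by simp
  next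
    assume "v - u \<in> R"
    then show "v \<in> tensor_class M N u"
      by (auto simp: tensor_class_def r_coset_def intro!: bexI[of _ "v - u"])
  qed
  then show ?thesis by (auto simp: tensor_cong_def)
qed

lemma class_eq_iff: "tensor_class M N u = tensor_class M N v \<longleftrightarrow> u \<sim> v"
  unfolding class_eq_Collect using cong_refl cong_sym cong_trans by blast

lemma mem_class_F: "u \<in> F \<Longrightarrow> v \<in> tensor_class M N u \<Longrightarrow> v \<in> F"
  using F_add[OF rel_F, of "v - u" u] unfolding class_eq_Collect tensor_cong_def mem_Collect_eq diff_add_cancel .

lemma mem_class_cong: "v \<in> tensor_class M N u \<Longrightarrow> v \<sim> u"
  by (simp add: class_eq_Collect)

lemma class_nonempty: "tensor_class M N u \<noteq> {}"
  using cong_refl by (auto simp: class_eq_Collect)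

lemma carrier_tensor_dg: "carrier (tensor_dg M N) = tensor_class M N ` F"
  by (auto simp: tensor_dg_def tensor_group_def tensor_class_def FactGroup_def RCOSETS_def)

lemma tensor_dg_add:
  assumes "u \<in> F" "v \<in> F"
  shows "tensor_class M N u \<oplus>\<^bsub>tensor_dg M N\<^esub> tensor_class M N v = tensor_class M N (u + v)"
proof -
  interpret normal R "tensor_free M N"
    by (rule F.subgroup_imp_normal[OF subgroup_rel])
  show ?thesis
    using rcos_sum[of u v] assms
    by (simp add: tensor_dg_def tensor_group_def tensor_class_def)
qed

lemma tensor_dg_one: "\<one>\<^bsub>tensor_dg M N\<^esub> = tensor_class M N (frag_of (\<one>\<^bsub>M\<^esub>, \<one>\<^bsub>N\<^esub>))"
  by (simp add: tensor_dg_def pure_tensor_def)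

lemma tensor_group_comm_group: "comm_group (tensor_group M N)"
  unfolding tensor_group_def by (rule F.abelian_FactGroup[OF subgroup_rel])

lemma tensor_group_mult:
  "u \<in> F \<Longrightarrow> v \<in> F \<Longrightarrow> tensor_class M N u \<otimes>\<^bsub>tensor_group M N\<^esub> tensor_class M N v = tensor_class M N (u + v)"
  using tensor_dg_add by (simp add: tensor_dg_def)

lemma tensor_group_one: "\<one>\<^bsub>tensor_group M N\<^esub> = tensor_class M N 0"
proof -
  have "R = {v. v \<sim> 0}" by (auto simp: cong_zero_iff)
  then show ?thesis by (simp add: tensor_group_def class_eq_Collect FactGroup_def)
qed

lemma tensor_group_carrier: "carrier (tensor_group M N) = tensor_class M N ` F"
  using carrier_tensor_dg by (simp add: tensor_dg_def)

lemma tensor_group_inv: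
  assumes "u \<in> F"
  shows "inv\<^bsub>tensor_group M N\<^esub> tensor_class M N u = tensor_class M N (- u)"
proof -
  interpret G: comm_group "tensor_group M N" by (rule tensor_group_comm_group)
  show ?thesis
    by (rule G.inv_equality)
      (use assms F_minus[OF assms] in \<open>auto simp: tensor_group_mult tensor_group_one tensor_group_carrier
        simp del: carrier_free_Abelian_group_iff\<close>)
qed

end

section \<open>The product on representatives\<close>

definition tensor_mult_term ::
    "'a dg_ring \<Rightarrow> 'b dg_ring \<Rightarrow> int \<Rightarrow> int \<Rightarrow> 'a \<times> 'b \<Rightarrow> 'a \<times> 'b \<Rightarrow> ('a \<times> 'b \<Rightarrow>\<^sub>0 int)" where
  "tensor_mult_term M N i j = (\<lambda>(x, y) (x', y'). frag_cmul (ksign (i * j))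
     (frag_of (x \<otimes>\<^bsub>M\<^esub> dg_comp M j x', dg_comp N i y \<otimes>\<^bsub>N\<^esub> y')))"

definition tensor_mult_rep ::
    "'a dg_ring \<Rightarrow> 'b dg_ring \<Rightarrow> ('a \<times> 'b \<Rightarrow>\<^sub>0 int) \<Rightarrow> ('a \<times> 'b \<Rightarrow>\<^sub>0 int) \<Rightarrow> ('a \<times> 'b \<Rightarrow>\<^sub>0 int)" where
  "tensor_mult_rep M N u v = frag_extend (\<lambda>g. frag_extend (tensor_mult_gen M N g) v) u"

locale weak_dg_ring_pair = M: weak_dg_ring M + N: weak_dg_ring N
  for M :: "'a dg_ring" and N :: "'b dg_ring"

sublocale weak_dg_ring_pair \<subseteq> abelian_group_pair M N ..

context weak_dg_ring_pair
begin

lemma cong_zero_left: "y \<in> carrier N \<Longrightarrow> frag_of (\<zero>\<^bsub>M\<^esub>, y) \<sim> 0"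
  by (rule additive_cong_zero[OF M.abelian_group_axioms]) (rule cong_left)

lemma cong_zero_right: "x \<in> carrier M \<Longrightarrow> frag_of (x, \<zero>\<^bsub>N\<^esub>) \<sim> 0"
  by (rule additive_cong_zero[OF N.abelian_group_axioms]) (rule cong_right)

lemma cong_cmul_zero: "u \<sim> 0 \<Longrightarrow> frag_cmul k u \<sim> 0"
  using cong_cmul[of u 0 k] by simp

lemma cong_cmul_add: "u \<sim> v + w \<Longrightarrow> frag_cmul k u \<sim> frag_cmul k v + frag_cmul k w"
  using cong_cmul[of u "v + w" k] by (simp only: frag_cmul_distrib2)

lemma mult_gen_F:
  "g \<in> carrier M \<times> carrier N \<Longrightarrow> g' \<in> carrier M \<times> carrier N \<Longrightarrow> tensor_mult_gen M N g g' \<in> F"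
  unfolding tensor_mult_gen_def
  by (auto intro!: sum_closed_free_Abelian_group F_cmul M.mult_closed N.mult_closed M.comp_closed N.comp_closed
      simp del: carrier_free_Abelian_group_iff)

text \<open>The extra summands have a zero entry. This frees the sum from the supports of the
  particular arguments and leaves single terms \<open>tensor_mult_term\<close>, which make sense in
  all degrees and are additive in each entry modulo the relations.\<close>

lemma mult_gen_cong_sum:
  assumes g: "x \<in> carrier M" "y \<in> carrier N" "x' \<in> carrier M" "y' \<in> carrier N"
    and S: "finite S" "dg_supp N y \<subseteq> S" and T: "finite T" "dg_supp M x' \<subseteq> T"
  shows "tensor_mult_gen M N (x, y) (x', y') \<sim> (\<Sum>i\<in>S. \<Sum>j\<in>T. tensor_mult_term M N i j (x, y) (x', y'))"
proof -
  let ?t = "\<lambda>i j. tensor_mult_term M N i j (x, y) (x', y')"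
  have "tensor_mult_gen M N (x, y) (x', y') = (\<Sum>i\<in>dg_supp N y. \<Sum>j\<in>dg_supp M x'. ?t i j)"
    by (simp add: tensor_mult_gen_def tensor_mult_term_def)
  also have "\<dots> \<sim> (\<Sum>i\<in>dg_supp N y. \<Sum>j\<in>T. ?t i j)"
  proof (intro cong_sum cong_sum_neutral[OF T])
    fix i j assume "j \<in> T - dg_supp M x'"
    then have "dg_comp M j x' = \<zero>\<^bsub>M\<^esub>" by (simp add: dg_supp_def)
    then show "?t i j \<sim> 0"
      using g by (simp add: tensor_mult_term_def M.mult_zero_right cong_cmul_zero cong_zero_left
          N.mult_closed N.comp_closed)
  qed
  also have "\<dots> \<sim> (\<Sum>i\<in>S. \<Sum>j\<in>T. ?t i j)"
  proof (rule cong_sum_neutral[OF S])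
    fix i assume "i \<in> S - dg_supp N y"
    then have "dg_comp N i y = \<zero>\<^bsub>N\<^esub>" by (simp add: dg_supp_def)
    then have "?t i j \<sim> 0" for j
      using g by (simp add: tensor_mult_term_def N.mult_zero_left cong_cmul_zero cong_zero_right
          M.mult_closed M.comp_closed)
    then show "(\<Sum>j\<in>T. ?t i j) \<sim> 0"
      using cong_sum[of T "?t i" "\<lambda>_. 0"] by simp
  qed
  finally show ?thesis .
qed

text \<open>Sums over the unions of the three supports reduce additivity of the product to that of
  one summand. The form with \<open>g\<close>, \<open>h\<close>, \<open>k\<close> covers additivity
  in each of the four entries.\<close>

lemma mult_gen_add:
  assumes g: "g \<in> carrier M \<times> carrier N" "h \<in> carrier M \<times> carrier N" "k \<in> carrier M \<times> carrier N"
    "g' \<in> carrier M \<times> carrier N" "h' \<in> carrier M \<times> carrier N" "k' \<in> carrier M \<times> carrier N"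
    and add: "\<And>i j. tensor_mult_term M N i j k k' \<sim> tensor_mult_term M N i j g g' + tensor_mult_term M N i j h h'"
  shows "tensor_mult_gen M N k k' \<sim> tensor_mult_gen M N g g' + tensor_mult_gen M N h h'"
proof -
  let ?S = "dg_supp N (snd g) \<union> dg_supp N (snd h) \<union> dg_supp N (snd k)"
  let ?T = "dg_supp M (fst g') \<union> dg_supp M (fst h') \<union> dg_supp M (fst k')"
  have fin: "finite ?S" "finite ?T"
    using g by (auto intro: M.finite_supp N.finite_supp)
  have *: "tensor_mult_gen M N l l' \<sim> (\<Sum>i\<in>?S. \<Sum>j\<in>?T. tensor_mult_term M N i j l l')"
    if "l \<in> carrier M \<times> carrier N" "l' \<in> carrier M \<times> carrier N"
      "dg_supp N (snd l) \<subseteq> ?S" "dg_supp M (fst l') \<subseteq> ?T" for l l'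
    using that mult_gen_cong_sum[OF _ _ _ _ fin(1) _ fin(2)] by (cases l; cases l') auto
  have "tensor_mult_gen M N k k' \<sim> (\<Sum>i\<in>?S. \<Sum>j\<in>?T. tensor_mult_term M N i j k k')"
    using g by (intro *) auto
  also have "\<dots> \<sim> (\<Sum>i\<in>?S. \<Sum>j\<in>?T. tensor_mult_term M N i j g g' + tensor_mult_term M N i j h h')"
    by (intro cong_sum add)
  also have "\<dots> = (\<Sum>i\<in>?S. \<Sum>j\<in>?T. tensor_mult_term M N i j g g') +
      (\<Sum>i\<in>?S. \<Sum>j\<in>?T. tensor_mult_term M N i j h h')"
    by (simp only: sum.distrib)
  also have "\<dots> \<sim> tensor_mult_gen M N g g' + tensor_mult_gen M N h h'"
    using g by (intro cong_add cong_sym[OF *]) auto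
  finally show ?thesis .
qed

lemma mult_rep_F: "u \<in> F \<Longrightarrow> v \<in> F \<Longrightarrow> tensor_mult_rep M N u v \<in> F"
  unfolding tensor_mult_rep_def by (intro F_extend mult_gen_F)

lemma mult_rep_diff_left: "tensor_mult_rep M N (u - u') v = tensor_mult_rep M N u v - tensor_mult_rep M N u' v"
  by (simp add: tensor_mult_rep_def frag_extend_diff)

lemma mult_rep_diff_right: "tensor_mult_rep M N u (v - v') = tensor_mult_rep M N u v - tensor_mult_rep M N u v'"
  by (simp add: tensor_mult_rep_def frag_extend_diff frag_extend_fun_diff)

text \<open>A combination of relations is a relation, so \<open>u\<close> may be taken to be a
  single generator; \<open>extend_rel\<close> then handles \<open>v\<close>.\<close>

lemma mult_rep_rel_right:
  assumes "u \<in> F" "v \<in> R"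
  shows "tensor_mult_rep M N u v \<in> R"
  unfolding tensor_mult_rep_def
proof (rule rel_extend)
  fix g assume "g \<in> Poly_Mapping.keys u"
  then obtain a b where g: "g = (a, b)" "a \<in> carrier M" "b \<in> carrier N"
    using assms(1) by auto
  show "frag_extend (tensor_mult_gen M N g) v \<in> R"
  proof (rule extend_rel[OF abelian_group_pair_axioms _ _ assms(2)])
    fix x x' y assume "x \<in> carrier M" "x' \<in> carrier M" "y \<in> carrier N"
    then show "tensor_mult_gen M N g (x \<oplus>\<^bsub>M\<^esub> x', y) \<sim> tensor_mult_gen M N g (x, y) + tensor_mult_gen M N g (x', y)"
      using g by (intro mult_gen_add)
        (auto simp: tensor_mult_term_def M.comp_add M.distr_right M.comp_closed N.comp_closed M.mult_closed N.mult_closed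
          intro!: cong_cmul_add cong_left)
  next
    fix x y y' assume "x \<in> carrier M" "y \<in> carrier N" "y' \<in> carrier N"
    then show "tensor_mult_gen M N g (x, y \<oplus>\<^bsub>N\<^esub> y') \<sim> tensor_mult_gen M N g (x, y) + tensor_mult_gen M N g (x, y')"
      using g by (intro mult_gen_add)
        (auto simp: tensor_mult_term_def N.distr_right M.comp_closed N.comp_closed M.mult_closed N.mult_closed
          intro!: cong_cmul_add cong_right)
  qed
qed

lemma mult_rep_rel_left:
  assumes "u \<in> R" "v \<in> F"
  shows "tensor_mult_rep M N u v \<in> R"
proof -
  \<comment> \<open>The fixed factor \<open>v\<close> is now the inner argument, so additivity
    against single generators has to be spread over \<open>v\<close> before
    \<open>extend_rel\<close> can be used.\<close>
  have *: "frag_extend (tensor_mult_gen M N k) v \<sim>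
      frag_extend (tensor_mult_gen M N g) v + frag_extend (tensor_mult_gen M N h) v"
    if "\<And>c. c \<in> carrier M \<times> carrier N \<Longrightarrow> tensor_mult_gen M N k c \<sim> tensor_mult_gen M N g c + tensor_mult_gen M N h c"
    for g h k
    using assms(2)[unfolded carrier_free_Abelian_group_iff]
  proof (induction v rule: frag_induction)
    case (diff a b)
    then show ?case
      using cong_diff[OF diff] by (simp only: frag_extend_diff add_diff_add_eq)
  qed (use that cong_refl in auto)
  show ?thesis
    unfolding tensor_mult_rep_def
  proof (rule extend_rel[OF abelian_group_pair_axioms _ _ assms(1)])
    fix x x' y assume "x \<in> carrier M" "x' \<in> carrier M" "y \<in> carrier N"
    then show "frag_extend (tensor_mult_gen M N (x \<oplus>\<^bsub>M\<^esub> x', y)) v \<sim>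
        frag_extend (tensor_mult_gen M N (x, y)) v + frag_extend (tensor_mult_gen M N (x', y)) v"
      by (intro * mult_gen_add)
        (auto simp: tensor_mult_term_def M.distr_left M.comp_closed N.comp_closed M.mult_closed N.mult_closed
          intro!: cong_cmul_add cong_left)
  next
    fix x y y' assume "x \<in> carrier M" "y \<in> carrier N" "y' \<in> carrier N"
    then show "frag_extend (tensor_mult_gen M N (x, y \<oplus>\<^bsub>N\<^esub> y')) v \<sim>
        frag_extend (tensor_mult_gen M N (x, y)) v + frag_extend (tensor_mult_gen M N (x, y')) v"
      by (intro * mult_gen_add)
        (auto simp: tensor_mult_term_def N.comp_add N.distr_left M.comp_closed N.comp_closed M.mult_closed N.mult_closed
          intro!: cong_cmul_add cong_right)
  qed
qed

lemma mult_rep_cong: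
  assumes "u \<sim> u'" "v \<sim> v'" "u \<in> F" "u' \<in> F" "v \<in> F" "v' \<in> F"
  shows "tensor_mult_rep M N u v \<sim> tensor_mult_rep M N u' v'"
proof -
  have "tensor_mult_rep M N u v \<sim> tensor_mult_rep M N u' v"
    using mult_rep_rel_left[of "u - u'" v] assms by (simp add: tensor_cong_def mult_rep_diff_left)
  also have "\<dots> \<sim> tensor_mult_rep M N u' v'"
    using mult_rep_rel_right[of u' "v - v'"] assms by (simp add: tensor_cong_def mult_rep_diff_right)
  finally show ?thesis .
qed

lemma tensor_dg_mult:
  assumes "u \<in> F" "v \<in> F"
  shows "tensor_class M N u \<otimes>\<^bsub>tensor_dg M N\<^esub> tensor_class M N v = tensor_class M N (tensor_mult_rep M N u v)"
proof -
  have eq: "tensor_class M N (tensor_mult_rep M N u' v') = tensor_class M N (tensor_mult_rep M N u v)"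
    if "u' \<in> tensor_class M N u" "v' \<in> tensor_class M N v" for u' v'
    unfolding class_eq_iff
    by (intro mult_rep_cong mem_class_cong mem_class_F[OF assms(1)] mem_class_F[OF assms(2)] that assms)
  have "tensor_class M N u \<otimes>\<^bsub>tensor_dg M N\<^esub> tensor_class M N v =
      (\<Union>u'\<in>tensor_class M N u. \<Union>v'\<in>tensor_class M N v. tensor_class M N (tensor_mult_rep M N u' v'))"
    by (simp add: tensor_dg_def tensor_mult_rep_def)
  also have "\<dots> = tensor_class M N (tensor_mult_rep M N u v)"
    by (intro SUP_eq_const eq class_nonempty)
  finally show ?thesis .
qed

section \<open>The differential on representatives\<close>

definition d_term :: "int \<Rightarrow> 'a \<times> 'b \<Rightarrow> ('a \<times> 'b \<Rightarrow>\<^sub>0 int)" where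
  "d_term i = (\<lambda>(x, y). frag_cmul (ksign i) (frag_of (dg_comp M i x, dg_d N y)))"

lemma d_gen_F: "g \<in> carrier M \<times> carrier N \<Longrightarrow> tensor_d_gen M N g \<in> F"
  unfolding tensor_d_gen_def
  by (auto intro!: sum_closed_free_Abelian_group F_cmul F_add M.d_closed N.d_closed M.comp_closed
      simp del: carrier_free_Abelian_group_iff)

lemma d_gen_cong_sum:
  assumes g: "x \<in> carrier M" "y \<in> carrier N" and S: "finite S" "dg_supp M x \<subseteq> S"
  shows "tensor_d_gen M N (x, y) \<sim> frag_of (dg_d M x, y) + (\<Sum>i\<in>S. d_term i (x, y))"
proof -
  have "tensor_d_gen M N (x, y) = frag_of (dg_d M x, y) + (\<Sum>i\<in>dg_supp M x. d_term i (x, y))"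
    by (simp add: tensor_d_gen_def d_term_def)
  also have "\<dots> \<sim> frag_of (dg_d M x, y) + (\<Sum>i\<in>S. d_term i (x, y))"
  proof (intro cong_add cong_refl cong_sum_neutral[OF S])
    fix i assume "i \<in> S - dg_supp M x"
    then have "dg_comp M i x = \<zero>\<^bsub>M\<^esub>" by (simp add: dg_supp_def)
    then show "d_term i (x, y) \<sim> 0"
      using g by (simp add: d_term_def cong_cmul_zero cong_zero_left N.d_closed)
  qed
  finally show ?thesis .
qed

lemma d_gen_add:
  assumes g: "g \<in> carrier M \<times> carrier N" "h \<in> carrier M \<times> carrier N" "k \<in> carrier M \<times> carrier N"
    and add: "\<And>i. d_term i k \<sim> d_term i g + d_term i h"
      "frag_of (dg_d M (fst k), snd k) \<sim> frag_of (dg_d M (fst g), snd g) + frag_of (dg_d M (fst h), snd h)"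
  shows "tensor_d_gen M N k \<sim> tensor_d_gen M N g + tensor_d_gen M N h"
proof -
  let ?S = "dg_supp M (fst g) \<union> dg_supp M (fst h) \<union> dg_supp M (fst k)"
  let ?f = "\<lambda>l. frag_of (dg_d M (fst l), snd l)"
  have fin: "finite ?S"
    using g by (auto intro: M.finite_supp)
  have *: "tensor_d_gen M N l \<sim> ?f l + (\<Sum>i\<in>?S. d_term i l)"
    if "l \<in> carrier M \<times> carrier N" "dg_supp M (fst l) \<subseteq> ?S" for l
    using that d_gen_cong_sum[OF _ _ fin] by (cases l) auto
  have "tensor_d_gen M N k \<sim> ?f k + (\<Sum>i\<in>?S. d_term i k)"
    using g by (intro *) auto
  also have "\<dots> \<sim> (?f g + ?f h) + (\<Sum>i\<in>?S. d_term i g + d_term i h)"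
    by (intro cong_sum cong_add add)
  also have "\<dots> = (?f g + (\<Sum>i\<in>?S. d_term i g)) + (?f h + (\<Sum>i\<in>?S. d_term i h))"
    by (simp only: sum.distrib ac_simps)
  also have "\<dots> \<sim> tensor_d_gen M N g + tensor_d_gen M N h"
    using g by (intro cong_add cong_sym[OF *]) auto
  finally show ?thesis .
qed

lemma d_rep_F: "u \<in> F \<Longrightarrow> frag_extend (tensor_d_gen M N) u \<in> F"
  by (intro F_extend d_gen_F)

lemma d_rep_rel:
  assumes "u \<in> R"
  shows "frag_extend (tensor_d_gen M N) u \<in> R"
proof (rule extend_rel[OF abelian_group_pair_axioms _ _ assms])
  fix x x' y assume "x \<in> carrier M" "x' \<in> carrier M" "y \<in> carrier N"
  then show "tensor_d_gen M N (x \<oplus>\<^bsub>M\<^esub> x', y) \<sim> tensor_d_gen M N (x, y) + tensor_d_gen M N (x', y)"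
    by (intro d_gen_add)
      (auto simp: d_term_def M.comp_add M.comp_closed N.d_closed M.d_closed M.d_add
        intro!: cong_cmul_add cong_left)
next
  fix x y y' assume "x \<in> carrier M" "y \<in> carrier N" "y' \<in> carrier N"
  then show "tensor_d_gen M N (x, y \<oplus>\<^bsub>N\<^esub> y') \<sim> tensor_d_gen M N (x, y) + tensor_d_gen M N (x, y')"
    by (intro d_gen_add)
      (auto simp: d_term_def M.comp_closed N.d_closed M.d_closed N.d_add
        intro!: cong_cmul_add cong_right)
qed

lemma tensor_dg_d:
  assumes "u \<in> F"
  shows "dg_d (tensor_dg M N) (tensor_class M N u) = tensor_class M N (frag_extend (tensor_d_gen M N) u)"
proof -
  have "tensor_class M N (frag_extend (tensor_d_gen M N) u') = tensor_class M N (frag_extend (tensor_d_gen M N) u)"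
    if "u' \<in> tensor_class M N u" for u'
    using mem_class_cong[OF that] d_rep_rel[of "u' - u"]
    by (simp add: class_eq_iff tensor_cong_def frag_extend_diff)
  then have "(\<Union>u'\<in>tensor_class M N u. tensor_class M N (frag_extend (tensor_d_gen M N) u')) =
      tensor_class M N (frag_extend (tensor_d_gen M N) u)"
    by (intro SUP_eq_const class_nonempty)
  then show ?thesis
    by (simp add: tensor_dg_def)
qed

lemma tensor_dg_one_closed: "\<one>\<^bsub>tensor_dg M N\<^esub> \<in> carrier (tensor_dg M N)"
  unfolding carrier_tensor_dg tensor_dg_one
  by (rule imageI) (simp add: M.one_closed N.one_closed)

lemma carrier_tensor_dgE:
  assumes "U \<in> carrier (tensor_dg M N)"
  obtains u where "u \<in> F" "U = tensor_class M N u"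
  using assms unfolding carrier_tensor_dg by blast

lemma tensor_dg_mult_closed:
  assumes "U \<in> carrier (tensor_dg M N)" "V \<in> carrier (tensor_dg M N)"
  shows "U \<otimes>\<^bsub>tensor_dg M N\<^esub> V \<in> carrier (tensor_dg M N)"
proof -
  obtain u where u: "u \<in> F" "U = tensor_class M N u" using assms(1) by (rule carrier_tensor_dgE)
  obtain v where v: "v \<in> F" "V = tensor_class M N v" using assms(2) by (rule carrier_tensor_dgE)
  show ?thesis
    unfolding u(2) v(2) carrier_tensor_dg tensor_dg_mult[OF u(1) v(1)] by (rule imageI[OF mult_rep_F[OF u(1) v(1)]])
qed

lemma tensor_dg_add_closed:
  assumes "U \<in> carrier (tensor_dg M N)" "V \<in> carrier (tensor_dg M N)"
  shows "U \<oplus>\<^bsub>tensor_dg M N\<^esub> V \<in> carrier (tensor_dg M N)"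
proof -
  obtain u where u: "u \<in> F" "U = tensor_class M N u" using assms(1) by (rule carrier_tensor_dgE)
  obtain v where v: "v \<in> F" "V = tensor_class M N v" using assms(2) by (rule carrier_tensor_dgE)
  show ?thesis
    unfolding u(2) v(2) carrier_tensor_dg tensor_dg_add[OF u(1) v(1)] by (rule imageI[OF F_add[OF u(1) v(1)]])
qed

lemma tensor_dg_d_closed:
  assumes "U \<in> carrier (tensor_dg M N)"
  shows "dg_d (tensor_dg M N) U \<in> carrier (tensor_dg M N)"
proof -
  obtain u where u: "u \<in> F" "U = tensor_class M N u" using assms by (rule carrier_tensor_dgE)
  show ?thesis
    unfolding u(2) carrier_tensor_dg tensor_dg_d[OF u(1)] by (rule imageI[OF d_rep_F[OF u(1)]])
qed

end

section \<open>Homomorphisms and functoriality in the left tensor factor\<close>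

locale weak_dg_hom = M: weak_dg_ring M + M': weak_dg_ring M'
  for M :: "'a dg_ring" and M' :: "'c dg_ring" +
  fixes h :: "'a \<Rightarrow> 'c"
  assumes hom_closed: "x \<in> carrier M \<Longrightarrow> h x \<in> carrier M'"
    and hom_add: "\<lbrakk>x \<in> carrier M; y \<in> carrier M\<rbrakk> \<Longrightarrow> h (x \<oplus>\<^bsub>M\<^esub> y) = h x \<oplus>\<^bsub>M'\<^esub> h y"
    and hom_mult: "\<lbrakk>x \<in> carrier M; y \<in> carrier M\<rbrakk> \<Longrightarrow> h (x \<otimes>\<^bsub>M\<^esub> y) = h x \<otimes>\<^bsub>M'\<^esub> h y"
    and hom_one: "h \<one>\<^bsub>M\<^esub> = \<one>\<^bsub>M'\<^esub>"
    and hom_part: "x \<in> dg_part M i \<Longrightarrow> h x \<in> dg_part M' i"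
    and hom_d: "x \<in> carrier M \<Longrightarrow> h (dg_d M x) = dg_d M' (h x)"
begin

lemma hom_comp: "x \<in> carrier M \<Longrightarrow> dg_comp M' i (h x) = h (dg_comp M i x)"
  by (rule M.comp_hom[OF M'.weak_dg_ring_axioms]) (auto simp: hom_closed hom_add hom_part)

lemma hom_zero: "h \<zero>\<^bsub>M\<^esub> = \<zero>\<^bsub>M'\<^esub>"
  using hom_add[of "\<zero>\<^bsub>M\<^esub>" "\<zero>\<^bsub>M\<^esub>"] hom_closed[of "\<zero>\<^bsub>M\<^esub>"] by (simp add: M'.add.l_cancel_one')

text \<open>Only an inclusion, as \<open>h\<close> may kill components. Hence \<open>map_rep\<close>
  respects the product and the differential of generators only up to congruence, with
  \<open>mult_gen_cong_sum\<close> and \<open>d_gen_cong_sum\<close> absorbing the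
  difference.\<close>

lemma hom_supp: "x \<in> carrier M \<Longrightarrow> dg_supp M' (h x) \<subseteq> dg_supp M x"
  by (auto simp: dg_supp_def hom_comp hom_zero)

end

locale tensor_left_map = weak_dg_hom M M' h + N: weak_dg_ring N
  for M :: "'a dg_ring" and M' :: "'c dg_ring" and h and N :: "'b dg_ring"

sublocale tensor_left_map \<subseteq> P: weak_dg_ring_pair M N ..
sublocale tensor_left_map \<subseteq> P': weak_dg_ring_pair M' N ..

context tensor_left_map
begin

abbreviation map_rep :: "('a \<times> 'b \<Rightarrow>\<^sub>0 int) \<Rightarrow> ('c \<times> 'b \<Rightarrow>\<^sub>0 int)" where
  "map_rep \<equiv> frag_extend (\<lambda>(x, y). frag_of (h x, y))"

lemma map_rep_F: "u \<in> P.F \<Longrightarrow> map_rep u \<in> P'.F"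
  by (rule P.F_extend) (auto simp: hom_closed simp del: carrier_free_Abelian_group_iff intro!: P'.F_minus)

lemma map_rep_rel: "u \<in> P.R \<Longrightarrow> map_rep u \<in> P'.R"
  by (rule P.extend_rel[OF P'.abelian_group_pair_axioms])
    (auto simp: hom_closed hom_add intro: P'.cong_left P'.cong_right)

lemma tensor_map_class:
  assumes "u \<in> P.F"
  shows "tensor_map M N M' N h id (tensor_class M N u) = tensor_class M' N (map_rep u)"
proof -
  have "tensor_class M' N (map_rep u') = tensor_class M' N (map_rep u)"
    if "u' \<in> tensor_class M N u" for u'
    using P.mem_class_cong[OF that] map_rep_rel[of "u' - u"]
    by (simp add: P'.class_eq_iff tensor_cong_def frag_extend_diff)
  then have "(\<Union>u'\<in>tensor_class M N u. tensor_class M' N (map_rep u')) = tensor_class M' N (map_rep u)"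
    by (intro SUP_eq_const P.class_nonempty)
  then show ?thesis
    using assms by (simp add: tensor_map_def P.carrier_tensor_dg image_eqI
        del: carrier_free_Abelian_group_iff)
qed

lemma map_rep_mult_gen:
  assumes "x \<in> carrier M" "y \<in> carrier N" "x' \<in> carrier M" "y' \<in> carrier N"
  shows "tensor_cong M' N (map_rep (tensor_mult_gen M N (x, y) (x', y')))
    (tensor_mult_gen M' N (h x, y) (h x', y'))"
proof -
  have "map_rep (tensor_mult_gen M N (x, y) (x', y')) =
      (\<Sum>i\<in>dg_supp N y. \<Sum>j\<in>dg_supp M x'. tensor_mult_term M' N i j (h x, y) (h x', y'))"
    using assms by (simp add: tensor_mult_gen_def tensor_mult_term_def frag_extend_sum N.finite_supp M.finite_supp
        frag_extend_cmul hom_comp hom_mult M.comp_closed)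
  then show ?thesis
    using P'.cong_sym[OF P'.mult_gen_cong_sum] assms hom_supp by (simp add: hom_closed M.finite_supp N.finite_supp)
qed

text \<open>Both sides are additive in \<open>u\<close> and in \<open>v\<close>, so two nested
  inductions reduce the claim to a pair of generators.\<close>

lemma map_rep_mult:
  assumes "u \<in> P.F" "v \<in> P.F"
  shows "tensor_cong M' N (map_rep (tensor_mult_rep M N u v)) (tensor_mult_rep M' N (map_rep u) (map_rep v))"
  using assms(1)[unfolded carrier_free_Abelian_group_iff]
proof (induction u rule: frag_induction)
  case zero
  then show ?case by (simp add: tensor_mult_rep_def P'.cong_refl)
next
  case (diff a b)
  then show ?case
    by (simp add: P.mult_rep_diff_left P'.mult_rep_diff_left frag_extend_diff P'.cong_diff)
next
  case (one g)
  show ?case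
    using assms(2)[unfolded carrier_free_Abelian_group_iff]
  proof (induction v rule: frag_induction)
    case zero
    then show ?case by (simp add: tensor_mult_rep_def frag_extend_eq_0 P'.cong_refl)
  next
    case (diff a b)
    then show ?case
      by (simp only: P.mult_rep_diff_right P'.mult_rep_diff_right frag_extend_diff P'.cong_diff)
  next
    case (one g')
    then show ?case
      using map_rep_mult_gen \<open>g \<in> carrier M \<times> carrier N\<close>
      by (cases g; cases g') (auto simp: tensor_mult_rep_def)
  qed
qed

lemma map_rep_d_gen:
  assumes "x \<in> carrier M" "y \<in> carrier N"
  shows "tensor_cong M' N (map_rep (tensor_d_gen M N (x, y))) (tensor_d_gen M' N (h x, y))"
proof -
  have "map_rep (tensor_d_gen M N (x, y)) =
      frag_of (dg_d M' (h x), y) + (\<Sum>i\<in>dg_supp M x. P'.d_term i (h x, y))"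
    using assms by (simp add: tensor_d_gen_def P'.d_term_def frag_extend_sum M.finite_supp
        frag_extend_cmul frag_extend_add hom_comp hom_d)
  then show ?thesis
    using P'.cong_sym[OF P'.d_gen_cong_sum] assms hom_supp by (simp add: hom_closed M.finite_supp)
qed

lemma map_rep_d:
  assumes "u \<in> P.F"
  shows "tensor_cong M' N (map_rep (frag_extend (tensor_d_gen M N) u)) (frag_extend (tensor_d_gen M' N) (map_rep u))"
  using assms[unfolded carrier_free_Abelian_group_iff]
proof (induction u rule: frag_induction)
  case (diff a b)
  then show ?case by (simp add: frag_extend_diff P'.cong_diff)
next
  case (one g)
  then show ?case using map_rep_d_gen by (cases g) auto
qed (simp add: P'.cong_refl)

abbreviation T :: "('a \<times> 'b \<Rightarrow>\<^sub>0 int) set \<Rightarrow> ('c \<times> 'b \<Rightarrow>\<^sub>0 int) set" where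
  "T \<equiv> tensor_map M N M' N h id"

lemma tensor_map_one: "T \<one>\<^bsub>tensor_dg M N\<^esub> = \<one>\<^bsub>tensor_dg M' N\<^esub>"
proof -
  have "frag_of (\<one>\<^bsub>M\<^esub>, \<one>\<^bsub>N\<^esub>) \<in> P.F" by (simp add: M.one_closed N.one_closed)
  from tensor_map_class[OF this] show ?thesis
    by (simp add: P.tensor_dg_one P'.tensor_dg_one hom_one)
qed

lemma tensor_map_closed:
  assumes "U \<in> carrier (tensor_dg M N)"
  shows "T U \<in> carrier (tensor_dg M' N)"
proof -
  obtain u where u: "u \<in> P.F" "U = tensor_class M N u" using assms by (rule P.carrier_tensor_dgE)
  show ?thesis
    unfolding u(2) tensor_map_class[OF u(1)] P'.carrier_tensor_dg by (rule imageI[OF map_rep_F[OF u(1)]])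
qed

lemma tensor_map_mult:
  assumes "U \<in> carrier (tensor_dg M N)" "V \<in> carrier (tensor_dg M N)"
  shows "T (U \<otimes>\<^bsub>tensor_dg M N\<^esub> V) = T U \<otimes>\<^bsub>tensor_dg M' N\<^esub> T V"
proof -
  obtain u where u: "u \<in> P.F" "U = tensor_class M N u" using assms(1) by (rule P.carrier_tensor_dgE)
  obtain v where v: "v \<in> P.F" "V = tensor_class M N v" using assms(2) by (rule P.carrier_tensor_dgE)
  show ?thesis
    unfolding u(2) v(2) tensor_map_class[OF u(1)] tensor_map_class[OF v(1)]
      P'.tensor_dg_mult[OF map_rep_F[OF u(1)] map_rep_F[OF v(1)]] P.tensor_dg_mult[OF u(1) v(1)]
      tensor_map_class[OF P.mult_rep_F[OF u(1) v(1)]] P'.class_eq_iff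
    by (rule map_rep_mult[OF u(1) v(1)])
qed

lemma tensor_map_add:
  assumes "U \<in> carrier (tensor_dg M N)" "V \<in> carrier (tensor_dg M N)"
  shows "T (U \<oplus>\<^bsub>tensor_dg M N\<^esub> V) = T U \<oplus>\<^bsub>tensor_dg M' N\<^esub> T V"
proof -
  obtain u where u: "u \<in> P.F" "U = tensor_class M N u" using assms(1) by (rule P.carrier_tensor_dgE)
  obtain v where v: "v \<in> P.F" "V = tensor_class M N v" using assms(2) by (rule P.carrier_tensor_dgE)
  show ?thesis
    unfolding u(2) v(2) tensor_map_class[OF u(1)] tensor_map_class[OF v(1)]
      P'.tensor_dg_add[OF map_rep_F[OF u(1)] map_rep_F[OF v(1)]] P.tensor_dg_add[OF u(1) v(1)]
      tensor_map_class[OF P.F_add[OF u(1) v(1)]] frag_extend_add ..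
qed

lemma tensor_map_d:
  assumes "U \<in> carrier (tensor_dg M N)"
  shows "T (dg_d (tensor_dg M N) U) = dg_d (tensor_dg M' N) (T U)"
proof -
  obtain u where u: "u \<in> P.F" "U = tensor_class M N u" using assms by (rule P.carrier_tensor_dgE)
  show ?thesis
    unfolding u(2) tensor_map_class[OF u(1)] P'.tensor_dg_d[OF map_rep_F[OF u(1)]] P.tensor_dg_d[OF u(1)]
      tensor_map_class[OF P.d_rep_F[OF u(1)]] P'.class_eq_iff
    by (rule map_rep_d[OF u(1)])
qed

end

section \<open>Cochains\<close>

lemma restrict_mono_maps:
  assumes "\<And>k. k \<le> p \<Longrightarrow> f k \<le> q" "\<And>k l. k \<le> l \<Longrightarrow> l \<le> p \<Longrightarrow> f k \<le> f l"
  shows "(\<lambda>k\<in>{..p}. f k) \<in> mono_maps p q"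
  using assms by (auto simp: mono_maps_def monotone_on_def)

lemma mono_maps_le: "f \<in> mono_maps p q \<Longrightarrow> k \<le> p \<Longrightarrow> f k \<le> q"
  by (auto simp: mono_maps_def)

lemma mono_maps_mono: "f \<in> mono_maps p q \<Longrightarrow> k \<le> l \<Longrightarrow> l \<le> p \<Longrightarrow> f k \<le> f l"
  by (auto simp: mono_maps_def monotone_on_def)

lemma mono_maps_outside: "f \<in> mono_maps p q \<Longrightarrow> \<not> k \<le> p \<Longrightarrow> f k = undefined"
  by (auto simp: mono_maps_def PiE_def extensional_def)

lemma mono_maps_eqI:
  "\<lbrakk>f \<in> mono_maps p q; g \<in> mono_maps p r; \<And>k. k \<le> p \<Longrightarrow> f k = g k\<rbrakk> \<Longrightarrow> f = g"
  using mono_maps_outside by (metis ext)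

lemma face_map: "(\<lambda>k\<in>{..p}. if k < i then k else Suc k) \<in> mono_maps p (Suc p)"
  by (rule restrict_mono_maps) auto

lemma degen_map: "i \<le> p \<Longrightarrow> (\<lambda>k\<in>{..Suc p}. if k \<le> i then k else k - 1) \<in> mono_maps (Suc p) p"
  by (rule restrict_mono_maps) auto

lemma front_map: "(\<lambda>k\<in>{..p}. k) \<in> mono_maps p (p + q)"
  by (rule restrict_mono_maps) auto

lemma back_map: "(\<lambda>k\<in>{..q}. p + k) \<in> mono_maps q (p + q)"
  by (rule restrict_mono_maps) auto

context simplicial_set
begin

lemma face_closed: "x \<in> simplices X (Suc p) \<Longrightarrow> face X p i x \<in> simplices X p"
  unfolding face_def by (rule act_closed[OF face_map])

lemma front_face_closed: "x \<in> simplices X (p + q) \<Longrightarrow> front_face X p q x \<in> simplices X p"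
  unfolding front_face_def by (rule act_closed[OF front_map])

lemma back_face_closed: "x \<in> simplices X (p + q) \<Longrightarrow> back_face X p q x \<in> simplices X q"
  unfolding back_face_def by (rule act_closed[OF back_map])

text \<open>Such an \<open>f\<close> equals \<open>f\<close> after \<open>?d\<close> after
  \<open>?s\<close>: merging \<open>j + 1\<close> into \<open>j\<close> and then skipping
  \<open>j + 1\<close> moves only the point \<open>j + 1\<close>, where \<open>f\<close> has the
  same value as at \<open>j\<close>. So \<open>f\<close> factors through a codegeneracy.\<close>

lemma degenerate_act:
  assumes f: "f \<in> mono_maps n q" "j < n" "f j = f (Suc j)" and y: "y \<in> simplices X q"
  shows "act X n q f y \<in> degenerate_simplices X n"
proof -
  obtain m where n: "n = Suc m" "j \<le> m" using f(2) by (cases n) auto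
  let ?s = "\<lambda>k\<in>{..Suc m}. if k \<le> j then k else k - 1"
  let ?d = "\<lambda>k\<in>{..m}. if k < Suc j then k else Suc k"
  have g: "compose {..m} f ?d \<in> mono_maps m q"
    using mono_maps_compose[OF face_map] f(1) n by blast
  have "f = compose {..Suc m} (compose {..m} f ?d) ?s"
  proof (rule mono_maps_eqI[OF f(1)[unfolded n] mono_maps_compose[OF degen_map[OF n(2)] g]])
    fix k assume k: "k \<le> Suc m"
    consider "k \<le> j" | "k = Suc j" | "k > Suc j" by linarith
    then show "f k = compose {..Suc m} (compose {..m} f ?d) ?s k"
      using k n f(3) by cases (auto simp: compose_def)
  qed
  then have "act X n q f y = act X (Suc m) m ?s (act X m q (compose {..m} f ?d) y)"
    using act_comp[OF degen_map[OF n(2)] g y] n by simp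
  then show ?thesis
    using n act_closed[OF g y] unfolding degenerate_simplices_def degen_def by blast
qed

lemma degenerate_simplicesE:
  assumes "x \<in> degenerate_simplices X n"
  obtains p j y where "n = Suc p" "j \<le> p" "y \<in> simplices X p" "x = degen X p j y"
  using assms unfolding degenerate_simplices_def by blast

lemma act_degen:
  assumes "f \<in> mono_maps n (Suc p)" "j \<le> p" "y \<in> simplices X p"
  shows "act X n (Suc p) f (degen X p j y) = act X n p (compose {..n} (\<lambda>k\<in>{..Suc p}. if k \<le> j then k else k - 1) f) y"
  unfolding degen_def using act_comp[OF assms(1) degen_map assms(3)] assms(2) by simp

text \<open>Followed by the codegeneracy merging \<open>j\<close> and \<open>j + 1\<close>, a map
  hitting both at consecutive positions repeats a value, and \<open>degenerate_act\<close>
  applies.\<close>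

lemma degenerate_act_degen:
  assumes f: "f \<in> mono_maps n (Suc p)" and y: "j \<le> p" "y \<in> simplices X p"
    and k: "k < n" "f k = j" "f (Suc k) = Suc j"
  shows "act X n (Suc p) f (degen X p j y) \<in> degenerate_simplices X n"
  unfolding act_degen[OF f y]
  by (rule degenerate_act[OF mono_maps_compose[OF f degen_map[OF y(1)]] k(1) _ y(2)])
    (use k y in \<open>auto simp: compose_def\<close>)

text \<open>The front face has the vertices up to \<open>p\<close>, the back face those from
  \<open>p\<close> on. As they overlap in \<open>p\<close>, the merged pair \<open>j\<close>,
  \<open>j + 1\<close> lies wholly in one of them. This keeps Alexander-Whitney products
  normalized.\<close>

lemma front_or_back_face_degenerate:
  assumes x: "x \<in> degenerate_simplices X (p + q)"
  shows "front_face X p q x \<in> degenerate_simplices X p \<or> back_face X p q x \<in> degenerate_simplices X q"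
proof -
  obtain r j y where r: "p + q = Suc r" and j: "j \<le> r" and y: "y \<in> simplices X r" and x: "x = degen X r j y"
    using x by (rule degenerate_simplicesE)
  show ?thesis
  proof (cases "j < p")
    case True
    then have "front_face X p q x \<in> degenerate_simplices X p"
      unfolding x front_face_def r
      by (intro degenerate_act_degen[OF front_map[of p q, unfolded r] j y, of j]) auto
    then show ?thesis ..
  next
    case False
    then have "back_face X p q x \<in> degenerate_simplices X q"
      unfolding x back_face_def r using r j
      by (intro degenerate_act_degen[OF back_map[where p = p and q = q, unfolded r] j y, of "j - p"]) auto
    then show ?thesis ..
  qed
qed

text \<open>The face omits only vertex \<open>i\<close>, so \<open>j\<close> and
  \<open>j + 1\<close> are both still hit: at positions \<open>j - 1\<close> and \<open>j\<close> if
  \<open>i < j\<close>, at \<open>j\<close> and \<open>j + 1\<close> if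
  \<open>i > j + 1\<close>.\<close>

lemma face_degen_degenerate:
  assumes "j \<le> p" "y \<in> simplices X p" "i \<le> Suc p" "i \<noteq> j" "i \<noteq> Suc j"
  shows "face X p i (degen X p j y) \<in> degenerate_simplices X p"
  unfolding face_def
  by (rule degenerate_act_degen[OF face_map assms(1,2), of "if i < j then j - 1 else j"])
    (use assms in auto)

lemma face_degen_id:
  assumes "j \<le> p" "y \<in> simplices X p" "i = j \<or> i = Suc j"
  shows "face X p i (degen X p j y) = y"
proof -
  let ?s = "\<lambda>k\<in>{..Suc p}. if k \<le> j then k else k - 1"
  have "compose {..p} ?s (\<lambda>k\<in>{..p}. if k < i then k else Suc k) = (\<lambda>k\<in>{..p}. k)"
    using assms(1,3) by (auto simp: compose_def fun_eq_iff)
  then show ?thesis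
    unfolding face_def act_degen[OF face_map assms(1,2)] using act_id[OF assms(2)] by simp
qed

section \<open>Normalized cochains as a graded group with product and differential\<close>

lemma cochain_zero:
  "\<phi> \<in> cochain_carrier X \<Longrightarrow> x \<notin> simplices X p \<or> x \<in> degenerate_simplices X p \<Longrightarrow> \<phi> p x = 0"
  unfolding cochain_carrier_def by blast

lemma cochain_finite: "\<phi> \<in> cochain_carrier X \<Longrightarrow> finite {p. \<exists>x. \<phi> p x \<noteq> 0}"
  unfolding cochain_carrier_def by blast

lemma cochain_carrierI:
  assumes "finite S" "\<And>p x. p \<notin> S \<Longrightarrow> \<phi> p x = 0"
    "\<And>p x. x \<notin> simplices X p \<Longrightarrow> \<phi> p x = 0" "\<And>p x. x \<in> degenerate_simplices X p \<Longrightarrow> \<phi> p x = 0"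
  shows "\<phi> \<in> cochain_carrier X"
proof -
  have "{p. \<exists>x. \<phi> p x \<noteq> 0} \<subseteq> S" using assms(2) by blast
  then show ?thesis
    using assms finite_subset unfolding cochain_carrier_def by blast
qed

lemma cochain_add_closed:
  assumes "\<phi> \<in> cochain_carrier X" "\<psi> \<in> cochain_carrier X"
  shows "(\<lambda>p x. \<phi> p x + \<psi> p x) \<in> cochain_carrier X"
  by (rule cochain_carrierI[of "{p. \<exists>x. \<phi> p x \<noteq> 0} \<union> {p. \<exists>x. \<psi> p x \<noteq> 0}"])
    (use assms in \<open>auto simp: cochain_zero cochain_finite\<close>)

lemma cochain_cmul_closed:
  assumes "\<phi> \<in> cochain_carrier X"
  shows "(\<lambda>p x. k * \<phi> p x) \<in> cochain_carrier X"
  by (rule cochain_carrierI[of "{p. \<exists>x. \<phi> p x \<noteq> 0}"])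
    (use assms in \<open>auto simp: cochain_zero cochain_finite\<close>)

lemma cochain_mult_closed:
  assumes "\<phi> \<in> cochain_carrier X" "\<psi> \<in> cochain_carrier X"
  shows "cochain_mult X \<phi> \<psi> \<in> cochain_carrier X"
proof (rule cochain_carrierI)
  let ?S = "{p. \<exists>x. \<phi> p x \<noteq> 0}" and ?T = "{p. \<exists>x. \<psi> p x \<noteq> 0}"
  show "finite ((\<lambda>(p, q). p + q) ` (?S \<times> ?T))"
    using assms by (intro finite_imageI finite_cartesian_product) (auto intro: cochain_finite)
  show "cochain_mult X \<phi> \<psi> n x = 0" if "n \<notin> (\<lambda>(p, q). p + q) ` (?S \<times> ?T)" for n x
  proof -
    have "\<phi> p y * \<psi> (n - p) z = 0" if "p \<le> n" for p y z
    proof (rule ccontr)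
      assume "\<phi> p y * \<psi> (n - p) z \<noteq> 0"
      then have "(p, n - p) \<in> ?S \<times> ?T" by auto
      then have "p + (n - p) \<in> (\<lambda>(p, q). p + q) ` (?S \<times> ?T)" by (rule rev_image_eqI) simp
      then show False using \<open>n \<notin> _\<close> \<open>p \<le> n\<close> by simp
    qed
    then show ?thesis unfolding cochain_mult_def by (auto intro!: sum.neutral)
  qed
  show "cochain_mult X \<phi> \<psi> n x = 0" if "x \<notin> simplices X n" for n x
    using that by (simp add: cochain_mult_def)
  show "cochain_mult X \<phi> \<psi> n x = 0" if "x \<in> degenerate_simplices X n" for n x
  proof -
    have "\<phi> p (front_face X p (n - p) x) * \<psi> (n - p) (back_face X p (n - p) x) = 0" if "p \<le> n" for p
      using front_or_back_face_degenerate[of x p "n - p"] \<open>x \<in> _\<close> \<open>p \<le> n\<close> cochain_zero assms by auto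
    then show ?thesis unfolding cochain_mult_def by (auto intro!: sum.neutral)
  qed
qed

lemma cochain_d_closed:
  assumes "\<phi> \<in> cochain_carrier X"
  shows "cochain_d X \<phi> \<in> cochain_carrier X"
proof (rule cochain_carrierI)
  let ?S = "{p. \<exists>x. \<phi> p x \<noteq> 0}"
  show "finite (Suc ` ?S)"
    using assms by (intro finite_imageI cochain_finite)
  show "cochain_d X \<phi> n x = 0" if "n \<notin> Suc ` ?S" for n x
    using that by (auto simp: cochain_d_def inj_image_mem_iff simp del: sum.atMost_Suc split: nat.split intro!: sum.neutral)
  show "cochain_d X \<phi> n x = 0" if "x \<notin> simplices X n" for n x
    using that by (cases n) (simp_all add: cochain_d_def)
  show "cochain_d X \<phi> n x = 0" if deg: "x \<in> degenerate_simplices X n" for n x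
  proof -
    obtain p j y where n: "n = Suc p" and j: "j \<le> p" and y: "y \<in> simplices X p" and x: "x = degen X p j y"
      using deg by (rule degenerate_simplicesE)
    let ?t = "\<lambda>i. (- 1) ^ i * \<phi> p (face X p i x)"
    \<comment> \<open>All faces of \<open>x\<close> except those with index \<open>j\<close> and
      \<open>j + 1\<close> are degenerate; these two both equal \<open>y\<close> and enter with
      opposite signs.\<close>
    have "(\<Sum>i\<le>Suc p. ?t i) = (\<Sum>i\<in>{j, Suc j}. ?t i)"
      by (rule sum.mono_neutral_right)
        (use j y face_degen_degenerate cochain_zero[OF assms] x in auto)
    also have "\<dots> = 0"
      using face_degen_id[OF j y] x by simp
    finally show ?thesis
      unfolding cochain_d_def n by simp
  qed
qed

abbreviation C :: "(nat \<Rightarrow> 'x \<Rightarrow> int) dg_ring" where "C \<equiv> cochains X"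

lemma abelian_group_cochains: "abelian_group C"
proof (rule abelian_groupI)
  fix \<phi> assume "\<phi> \<in> carrier C"
  then have "(\<lambda>p x. - 1 * \<phi> p x) \<in> carrier C"
    using cochain_cmul_closed[of \<phi> "- 1"] by (simp add: cochains_def)
  then show "\<exists>\<psi>\<in>carrier C. \<psi> \<oplus>\<^bsub>C\<^esub> \<phi> = \<zero>\<^bsub>C\<^esub>"
    by (rule bexI[rotated]) (simp add: cochains_def)
qed (auto simp: cochains_def cochain_add_closed algebra_simps intro: cochain_carrierI[of "{}"])

lemma finsum_cochains:
  assumes "finite I" "\<And>i. i \<in> I \<Longrightarrow> c i \<in> cochain_carrier X"
  shows "finsum C c I p x = (\<Sum>i\<in>I. c i p x)"
proof -
  interpret C: abelian_group C by (rule abelian_group_cochains)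
  show ?thesis using assms
  proof (induction I)
    case empty
    have "finsum C c {} p x = \<zero>\<^bsub>C\<^esub> p x" by simp
    then show ?case by (simp add: cochains_def del: C.finsum_empty)
  next
    case (insert i I)
    then have "c \<in> I \<rightarrow> carrier C" "c i \<in> carrier C" by (auto simp: cochains_def)
    then have "finsum C c (insert i I) = c i \<oplus>\<^bsub>C\<^esub> finsum C c I"
      using insert by (intro C.finsum_insert) auto
    then show ?case using insert by (simp add: cochains_def)
  qed
qed

text \<open>The map taking \<open>k\<close> to the pointwise multiple is a homomorphism from the
  integers, hence determined by its value \<open>\<phi>\<close> at 1.\<close>

lemma add_pow_cochains:
  fixes k :: int
  assumes "\<phi> \<in> cochain_carrier X"
  shows "[k] \<cdot>\<^bsub>C\<^esub> \<phi> = (\<lambda>p x. k * \<phi> p x)"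
proof -
  interpret C: abelian_group C by (rule abelian_group_cochains)
  let ?h = "\<lambda>k p x. k * \<phi> p x"
  have "group_hom integer_group (add_monoid C) ?h"
    using cochain_cmul_closed[OF assms]
    by (intro group_hom.intro group_hom_axioms.intro group_integer_group C.a_group homI)
      (auto simp: cochains_def algebra_simps)
  then have "?h (1 [^]\<^bsub>integer_group\<^esub> k) = ?h 1 [^]\<^bsub>add_monoid C\<^esub> k"
    by (rule group_hom.hom_int_pow) simp
  then show ?thesis by (simp add: add_pow_def)
qed

lemma component_closed:
  assumes "\<phi> \<in> cochain_carrier X"
  shows "(\<lambda>p x. if int p = i then \<phi> p x else 0) \<in> cochain_carrier X"
  by (rule cochain_carrierI[of "{p. \<exists>x. \<phi> p x \<noteq> 0}"])
    (use assms in \<open>auto simp: cochain_zero cochain_finite\<close>)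

text \<open>The equivalence gives existence and uniqueness of the decomposition at once. For
  uniqueness the sum is evaluated in dimension \<open>p\<close>, where only the summand of degree
  \<open>p\<close> contributes.\<close>

lemma homogeneous_decomp_cochains:
  assumes "\<phi> \<in> cochain_carrier X"
  shows "homogeneous_decomp C \<phi> c \<longleftrightarrow> c = (\<lambda>i p x. if int p = i then \<phi> p x else 0)"
proof
  assume "homogeneous_decomp C \<phi> c"
  then have c: "c i \<in> dg_part C i" and fin: "finite {i. c i \<noteq> \<zero>\<^bsub>C\<^esub>}"
    and \<phi>: "\<phi> = finsum C c {i. c i \<noteq> \<zero>\<^bsub>C\<^esub>}" for i
    unfolding homogeneous_decomp_def by auto
  have c': "c i \<in> cochain_carrier X" "int p \<noteq> i \<Longrightarrow> c i p x = 0" for i p x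
    using c[of i] by (auto simp: cochains_def)
  have z: "\<zero>\<^bsub>C\<^esub> p x = 0" for p x by (simp add: cochains_def)
  have "\<phi> p x = c (int p) p x" for p x
  proof -
    have "\<phi> p x = (\<Sum>i\<in>{i. c i \<noteq> \<zero>\<^bsub>C\<^esub>}. c i p x)"
      using arg_cong[OF \<phi>, of "\<lambda>f. f p x"] finsum_cochains[OF fin c'(1), where p = p and x = x] by (rule trans)
    also have "\<dots> = (\<Sum>i\<in>{i. c i \<noteq> \<zero>\<^bsub>C\<^esub>}. if i = int p then c (int p) p x else 0)"
      by (rule sum.cong) (auto simp: c'(2))
    also have "\<dots> = c (int p) p x"
      using z[of p x] by (simp add: sum.delta[OF fin])
    finally show ?thesis .
  qed
  then show "c = (\<lambda>i p x. if int p = i then \<phi> p x else 0)"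
    using c'(2) by (auto simp: fun_eq_iff)
next
  assume c: "c = (\<lambda>i p x. if int p = i then \<phi> p x else 0)"
  let ?S = "{i. c i \<noteq> \<zero>\<^bsub>C\<^esub>}"
  have S: "?S \<subseteq> int ` {p. \<exists>x. \<phi> p x \<noteq> 0}"
  proof
    fix i assume "i \<in> ?S"
    then obtain p x where "c i p x \<noteq> 0" by (auto simp: cochains_def fun_eq_iff)
    then show "i \<in> int ` {p. \<exists>x. \<phi> p x \<noteq> 0}" by (auto simp: c split: if_splits)
  qed
  have fin: "finite ?S"
    using S cochain_finite[OF assms] finite_subset by blast
  have cc: "c i \<in> cochain_carrier X" for i
    unfolding c by (rule component_closed[OF assms])
  have "\<phi> p x = finsum C c ?S p x" for p x
  proof -
    have "finsum C c ?S p x = (\<Sum>i\<in>?S. if i = int p then \<phi> p x else 0)"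
      unfolding finsum_cochains[OF fin cc] by (rule sum.cong) (auto simp: c)
    moreover have "int p \<in> ?S" if "\<phi> p x \<noteq> 0"
    proof -
      have "c (int p) p x \<noteq> \<zero>\<^bsub>C\<^esub> p x" using that by (simp add: c cochains_def)
      then show ?thesis by auto
    qed
    ultimately show ?thesis by (auto simp: sum.delta[OF fin])
  qed
  then have "\<phi> = finsum C c ?S" by blast
  moreover have "c i \<in> dg_part C i" for i
    using cc[of i] by (auto simp: cochains_def c)
  ultimately show "homogeneous_decomp C \<phi> c"
    using fin by (auto simp: homogeneous_decomp_def)
qed

lemma weak_dg_ring_cochains: "weak_dg_ring C"
proof (intro weak_dg_ring.intro weak_dg_ring_axioms.intro abelian_group_cochains)
  interpret C: abelian_group C by (rule abelian_group_cochains)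
  fix i
  show "additive_subgroup (dg_part C i) C"
  proof (rule additive_subgroup.intro, rule group.subgroupI[OF C.a_group])
    fix \<phi> assume \<phi>: "\<phi> \<in> dg_part C i"
    have "(\<lambda>p x. - 1 * \<phi> p x) \<in> carrier C" "(\<lambda>p x. - 1 * \<phi> p x) \<oplus>\<^bsub>C\<^esub> \<phi> = \<zero>\<^bsub>C\<^esub>"
      using cochain_cmul_closed[of \<phi> "- 1"] \<phi> by (auto simp: cochains_def)
    then have "inv\<^bsub>add_monoid C\<^esub> \<phi> = (\<lambda>p x. - 1 * \<phi> p x)"
      using \<phi> by (intro group.inv_equality[OF C.a_group]) (auto simp: cochains_def)
    then show "inv\<^bsub>add_monoid C\<^esub> \<phi> \<in> dg_part C i"
      using \<phi> cochain_cmul_closed[of \<phi> "- 1"] by (auto simp: cochains_def)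
  qed (auto simp: cochains_def cochain_add_closed intro: cochain_carrierI[of "{}"])
next
  fix \<phi> \<psi> \<chi> assume \<phi>: "\<phi> \<in> carrier C"
  show "\<exists>!c. homogeneous_decomp C \<phi> c"
    using homogeneous_decomp_cochains[of \<phi>] \<phi> by (simp add: cochains_def)
  show "dg_d C \<phi> \<in> carrier C"
    using cochain_d_closed[of \<phi>] \<phi> by (simp add: cochains_def)
  show "\<phi> \<otimes>\<^bsub>C\<^esub> \<psi> \<in> carrier C" if "\<psi> \<in> carrier C"
    using cochain_mult_closed[of \<phi> \<psi>] \<phi> that by (simp add: cochains_def)
  show "(\<phi> \<oplus>\<^bsub>C\<^esub> \<psi>) \<otimes>\<^bsub>C\<^esub> \<chi> = \<phi> \<otimes>\<^bsub>C\<^esub> \<chi> \<oplus>\<^bsub>C\<^esub> \<psi> \<otimes>\<^bsub>C\<^esub> \<chi>"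
    by (simp add: cochains_def cochain_mult_def fun_eq_iff sum.distrib algebra_simps del: sum.atMost_Suc)
  show "\<chi> \<otimes>\<^bsub>C\<^esub> (\<phi> \<oplus>\<^bsub>C\<^esub> \<psi>) = \<chi> \<otimes>\<^bsub>C\<^esub> \<phi> \<oplus>\<^bsub>C\<^esub> \<chi> \<otimes>\<^bsub>C\<^esub> \<psi>"
    by (simp add: cochains_def cochain_mult_def fun_eq_iff sum.distrib algebra_simps del: sum.atMost_Suc)
  show "dg_d C (\<phi> \<oplus>\<^bsub>C\<^esub> \<psi>) = dg_d C \<phi> \<oplus>\<^bsub>C\<^esub> dg_d C \<psi>"
    by (simp add: cochains_def cochain_d_def fun_eq_iff sum.distrib algebra_simps del: sum.atMost_Suc
        split: nat.split)
next
  have "x \<notin> degenerate_simplices X 0" for x by (auto elim: degenerate_simplicesE)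
  then have "(\<lambda>p x. if p = 0 \<and> x \<in> simplices X 0 then 1 else 0) \<in> cochain_carrier X"
    by (intro cochain_carrierI[of "{0}"]) auto
  then show "\<one>\<^bsub>C\<^esub> \<in> carrier C" by (simp add: cochains_def)
qed

end

sublocale simplicial_set \<subseteq> C: weak_dg_ring "cochains X"
  by (rule weak_dg_ring_cochains)

section \<open>Pullback of cochains along simplicial maps\<close>

lemma sset_hom_closed: "F \<in> sset_hom X Y \<Longrightarrow> x \<in> simplices X p \<Longrightarrow> F p x \<in> simplices Y p"
  by (auto simp: sset_hom_def)

lemma sset_hom_act:
  "F \<in> sset_hom X Y \<Longrightarrow> f \<in> mono_maps p q \<Longrightarrow> x \<in> simplices X q \<Longrightarrow> F p (act X p q f x) = act Y p q f (F q x)"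
  by (auto simp: sset_hom_def)

lemma sset_hom_degenerate:
  assumes F: "F \<in> sset_hom X Y" and X: "simplicial_set X" and x: "x \<in> degenerate_simplices X n"
  shows "F n x \<in> degenerate_simplices Y n"
proof -
  obtain p j y where n: "n = Suc p" and j: "j \<le> p" and y: "y \<in> simplices X p" and x: "x = degen X p j y"
    using x by (rule simplicial_set.degenerate_simplicesE[OF X])
  have "F n x = degen Y p j (F p y)"
    unfolding x n degen_def by (rule sset_hom_act[OF F degen_map[OF j] y])
  then show ?thesis
    using n j sset_hom_closed[OF F y] unfolding degenerate_simplices_def by blast
qed

text \<open>Commuting with faces gives compatibility with product and differential; commuting with
  degeneracies keeps the result normalized. Unlike \<open>dg_hom\<close>, \<open>weak_dg_hom\<close>
  asks for no extensionality, which \<open>cochain_pullback\<close> does not provide.\<close>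

lemma cochain_pullback_hom:
  assumes X: "simplicial_set X" and Y: "simplicial_set Y" and F: "F \<in> sset_hom X Y"
  shows "weak_dg_hom (cochains Y) (cochains X) (cochain_pullback X F)"
proof -
  interpret X: simplicial_set X by fact
  interpret Y: simplicial_set Y by fact
  note cl = sset_hom_closed[OF F]
  have closed: "cochain_pullback X F \<phi> \<in> cochain_carrier X" if "\<phi> \<in> cochain_carrier Y" for \<phi>
    by (rule X.cochain_carrierI[of "{p. \<exists>x. \<phi> p x \<noteq> 0}"])
      (use that sset_hom_degenerate[OF F X] Y.cochain_zero in \<open>auto simp: cochain_pullback_def Y.cochain_finite\<close>)
  show ?thesis
  proof (intro weak_dg_hom.intro weak_dg_hom_axioms.intro X.weak_dg_ring_cochains Y.weak_dg_ring_cochains)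
    fix \<phi> \<psi> assume "\<phi> \<in> carrier (cochains Y)" "\<psi> \<in> carrier (cochains Y)"
    show "cochain_pullback X F (\<phi> \<otimes>\<^bsub>cochains Y\<^esub> \<psi>) =
        cochain_pullback X F \<phi> \<otimes>\<^bsub>cochains X\<^esub> cochain_pullback X F \<psi>"
    proof (intro ext)
      fix n x
      have "front_face Y p (n - p) (F n x) = F p (front_face X p (n - p) x)"
        "back_face Y p (n - p) (F n x) = F (n - p) (back_face X p (n - p) x)"
        "front_face X p (n - p) x \<in> simplices X p" "back_face X p (n - p) x \<in> simplices X (n - p)"
        if "x \<in> simplices X n" "p \<le> n" for p
        using sset_hom_act[OF F front_map[of p "n - p"]] sset_hom_act[OF F back_map[where p = p and q = "n - p"]]
          X.front_face_closed[of x p "n - p"] X.back_face_closed[of x p "n - p"] that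
        by (auto simp: front_face_def back_face_def)
      then show "cochain_pullback X F (\<phi> \<otimes>\<^bsub>cochains Y\<^esub> \<psi>) n x =
          (cochain_pullback X F \<phi> \<otimes>\<^bsub>cochains X\<^esub> cochain_pullback X F \<psi>) n x"
        by (auto simp: cochains_def cochain_mult_def cochain_pullback_def cl intro!: sum.cong)
    qed
  next
    fix \<phi> assume "\<phi> \<in> carrier (cochains Y)"
    show "cochain_pullback X F (dg_d (cochains Y) \<phi>) = dg_d (cochains X) (cochain_pullback X F \<phi>)"
    proof (intro ext)
      fix n x
      have "face Y p i (F (Suc p) x) = F p (face X p i x)" if "x \<in> simplices X (Suc p)" for p i
        using sset_hom_act[OF F face_map that] by (simp add: face_def)
      then show "cochain_pullback X F (dg_d (cochains Y) \<phi>) n x = dg_d (cochains X) (cochain_pullback X F \<phi>) n x"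
        by (auto simp: cochains_def cochain_d_def cochain_pullback_def cl X.face_closed split: nat.split intro!: sum.cong)
    qed
  next
    show "cochain_pullback X F (\<phi> \<oplus>\<^bsub>cochains Y\<^esub> \<psi>) =
        cochain_pullback X F \<phi> \<oplus>\<^bsub>cochains X\<^esub> cochain_pullback X F \<psi>" for \<phi> \<psi>
      by (simp add: cochains_def cochain_pullback_def fun_eq_iff)
    show "cochain_pullback X F \<one>\<^bsub>cochains Y\<^esub> = \<one>\<^bsub>cochains X\<^esub>"
      by (simp add: cochains_def cochain_pullback_def fun_eq_iff cl)
    show "cochain_pullback X F \<phi> \<in> carrier (cochains X)" if "\<phi> \<in> carrier (cochains Y)" for \<phi>
      using that closed by (simp add: cochains_def)
    show "cochain_pullback X F \<phi> \<in> dg_part (cochains X) i" if "\<phi> \<in> dg_part (cochains Y) i" for \<phi> i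
      using that closed by (simp add: cochains_def) (simp add: cochain_pullback_def)
  qed
qed

section \<open>Values of cochains with coefficients\<close>

lemma (in abelian_group) finsum_delta:
  assumes "finite I" "f \<in> I \<rightarrow> carrier G"
  shows "(\<Oplus>\<^bsub>G\<^esub>j\<in>I. if j = i then f j else \<zero>\<^bsub>G\<^esub>) = (if i \<in> I then f i else \<zero>\<^bsub>G\<^esub>)"
proof (cases "i \<in> I")
  case True
  then show ?thesis using add.finprod_singleton_swap[OF _ assms] by simp
next
  case False
  then show ?thesis by (auto intro!: add.finprod_one_eqI)
qed

text \<open>The universal property of the free group only asserts existence, hence
  \<open>SOME\<close>. The values on generators fix the map on the carrier, so the choice is
  harmless there.\<close>

definition cochain_eval ::
    "'x sset \<Rightarrow> 'b dg_ring \<Rightarrow> nat \<Rightarrow> 'x \<Rightarrow> ((nat \<Rightarrow> 'x \<Rightarrow> int) \<times> 'b \<Rightarrow>\<^sub>0 int) \<Rightarrow> 'b" where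
  "cochain_eval X B p x = (SOME h. h \<in> hom (tensor_free (cochains X) B) (add_monoid B) \<and>
     (\<forall>\<phi>\<in>carrier (cochains X). \<forall>b\<in>carrier B. h (frag_of (\<phi>, b)) = [\<phi> p x] \<cdot>\<^bsub>B\<^esub> b))"

text \<open>Any representative may be chosen, because evaluation is constant on cosets
  (\<open>eval_cong\<close>).\<close>

definition NC_eval :: "'x sset \<Rightarrow> 'b dg_ring \<Rightarrow> nat \<Rightarrow> 'x \<Rightarrow> ('x, 'b) ncoch \<Rightarrow> 'b" where
  "NC_eval X B p x U = cochain_eval X B p x (SOME u. u \<in> U)"

text \<open>The dimension is recorded because one element of the type may be a simplex in several
  dimensions.\<close>

definition nondegenerate :: "'x sset \<Rightarrow> (nat \<times> 'x) set" where
  "nondegenerate X = {(p, x). x \<in> simplices X p \<and> x \<notin> degenerate_simplices X p}"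

text \<open>For finite \<open>nondegenerate X\<close>, the indicators of its members form a basis of
  \<open>N(X, \<int>)\<close>; tensored with \<open>B\<close>, this basis provides coordinates on
  \<open>N(X, B)\<close>.\<close>

definition delta_cochain :: "nat \<times> 'x \<Rightarrow> nat \<Rightarrow> 'x \<Rightarrow> int" where
  "delta_cochain s = (\<lambda>p x. if (p, x) = s then 1 else 0)"

locale finite_cochains = X: simplicial_set X + B: weak_dg_ring B
  for X :: "'x sset" and B :: "'b dg_ring" +
  assumes finite_nondegenerate: "finite (nondegenerate X)"

sublocale finite_cochains \<subseteq> weak_dg_ring_pair "cochains X" B ..

context finite_cochains
begin

abbreviation C :: "(nat \<Rightarrow> 'x \<Rightarrow> int) dg_ring" where "C \<equiv> cochains X"
abbreviation ev :: "nat \<Rightarrow> 'x \<Rightarrow> ((nat \<Rightarrow> 'x \<Rightarrow> int) \<times> 'b \<Rightarrow>\<^sub>0 int) \<Rightarrow> 'b" where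
  "ev \<equiv> cochain_eval X B"
abbreviation cochain_cong (infix "\<sim>" 50) where "u \<sim> v \<equiv> tensor_cong C B u v"

lemma carrier_C: "carrier C = cochain_carrier X"
  by (simp add: cochains_def)

lemma eval_spec: "ev p x \<in> hom (tensor_free C B) (add_monoid B) \<and>
    (\<forall>\<phi>\<in>carrier C. \<forall>b\<in>carrier B. ev p x (frag_of (\<phi>, b)) = [\<phi> p x] \<cdot>\<^bsub>B\<^esub> b)"
proof -
  let ?f = "\<lambda>(\<phi>, b). [\<phi> p x] \<cdot>\<^bsub>B\<^esub> b"
  have "?f ` (carrier C \<times> carrier B) \<subseteq> carrier (add_monoid B)"
    using B.add.int_pow_closed by auto
  then obtain h where "h \<in> hom (tensor_free C B) (add_monoid B)"
    and "\<And>g. g \<in> carrier C \<times> carrier B \<Longrightarrow> h (frag_of g) = ?f g"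
    using comm_group.free_Abelian_group_universal[OF B.a_comm_group] by blast
  then have "\<exists>h. h \<in> hom (tensor_free C B) (add_monoid B) \<and>
      (\<forall>\<phi>\<in>carrier C. \<forall>b\<in>carrier B. h (frag_of (\<phi>, b)) = [\<phi> p x] \<cdot>\<^bsub>B\<^esub> b)"
    by (intro exI[of _ h]) auto
  then show ?thesis
    unfolding cochain_eval_def by (rule someI_ex)
qed

lemma eval_group_hom: "group_hom (tensor_free C B) (add_monoid B) (ev p x)"
  using eval_spec by (intro group_hom.intro group_hom_axioms.intro B.a_group group_free_Abelian_group) blast

lemma eval_frag_of: "\<phi> \<in> carrier C \<Longrightarrow> b \<in> carrier B \<Longrightarrow> ev p x (frag_of (\<phi>, b)) = [\<phi> p x] \<cdot>\<^bsub>B\<^esub> b"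
  using eval_spec by blast

lemma eval_closed: "u \<in> F \<Longrightarrow> ev p x u \<in> carrier B"
  using group_hom.hom_closed[OF eval_group_hom] by simp

lemma eval_zero: "ev p x 0 = \<zero>\<^bsub>B\<^esub>"
  using group_hom.hom_one[OF eval_group_hom] by simp

lemma eval_add: "u \<in> F \<Longrightarrow> v \<in> F \<Longrightarrow> ev p x (u + v) = ev p x u \<oplus>\<^bsub>B\<^esub> ev p x v"
  using group_hom.hom_mult[OF eval_group_hom, of u v] by simp

lemma eval_minus: "u \<in> F \<Longrightarrow> ev p x (- u) = \<ominus>\<^bsub>B\<^esub> ev p x u"
  using group_hom.hom_inv[OF eval_group_hom, of u] by (simp add: a_inv_def)

lemma eval_diff: "u \<in> F \<Longrightarrow> v \<in> F \<Longrightarrow> ev p x (u - v) = ev p x u \<ominus>\<^bsub>B\<^esub> ev p x v"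
  using eval_add[of u "- v" p x] eval_minus[of v p x] by (simp add: a_minus_def)

lemma eval_sum:
  assumes "finite I" "\<And>i. i \<in> I \<Longrightarrow> u i \<in> F"
  shows "ev p x (\<Sum>i\<in>I. u i) = finsum B (\<lambda>i. ev p x (u i)) I"
  using assms
proof (induction I)
  case empty
  then show ?case by (simp add: eval_zero)
next
  case (insert i I)
  have "(\<Sum>i\<in>I. u i) \<in> F"
    using insert.prems by (intro sum_closed_free_Abelian_group) blast
  then show ?case
    using insert eval_closed by (simp add: eval_add Pi_iff del: carrier_free_Abelian_group_iff)
qed

text \<open>For fixed \<open>x\<close>, the multiple of \<open>b\<close> by \<open>\<phi>(x)\<close>
  is biadditive in \<open>\<phi>\<close> and \<open>b\<close>, so both kinds of generating relations
  lie in the kernel.\<close>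

lemma eval_rel:
  assumes "u \<in> R"
  shows "ev p x u = \<zero>\<^bsub>B\<^esub>"
proof -
  have "R \<subseteq> kernel (tensor_free C B) (add_monoid B) (ev p x)"
  proof (rule rel_subsetI[OF group_hom.subgroup_kernel[OF eval_group_hom]])
    fix \<phi> \<psi> b assume g: "\<phi> \<in> carrier C" "\<psi> \<in> carrier C" "b \<in> carrier B"
    have "(\<phi> \<oplus>\<^bsub>C\<^esub> \<psi>) p x = \<phi> p x + \<psi> p x" by (simp add: cochains_def)
    then have "ev p x (frag_of (\<phi> \<oplus>\<^bsub>C\<^esub> \<psi>, b)) = ev p x (frag_of (\<phi>, b)) \<oplus>\<^bsub>B\<^esub> ev p x (frag_of (\<psi>, b))"
      using g by (simp add: eval_frag_of B.add.int_pow_mult)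
    then show "frag_of (\<phi> \<oplus>\<^bsub>C\<^esub> \<psi>, b) - frag_of (\<phi>, b) - frag_of (\<psi>, b) \<in>
        kernel (tensor_free C B) (add_monoid B) (ev p x)"
      using g F_add[of "frag_of (\<phi>, b)" "frag_of (\<psi>, b)"] F_diff[of "frag_of (\<phi> \<oplus>\<^bsub>C\<^esub> \<psi>, b)" "frag_of (\<phi>, b) + frag_of (\<psi>, b)"]
      by (simp add: kernel_def diff_diff_eq eval_diff eval_add eval_closed a_minus_def B.r_neg)
  next
    fix \<phi> b c assume g: "\<phi> \<in> carrier C" "b \<in> carrier B" "c \<in> carrier B"
    have "ev p x (frag_of (\<phi>, b \<oplus>\<^bsub>B\<^esub> c)) = ev p x (frag_of (\<phi>, b)) \<oplus>\<^bsub>B\<^esub> ev p x (frag_of (\<phi>, c))"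
      using g by (simp add: eval_frag_of B.add.int_pow_distrib)
    then show "frag_of (\<phi>, b \<oplus>\<^bsub>B\<^esub> c) - frag_of (\<phi>, b) - frag_of (\<phi>, c) \<in>
        kernel (tensor_free C B) (add_monoid B) (ev p x)"
      using g F_add[of "frag_of (\<phi>, b)" "frag_of (\<phi>, c)"] F_diff[of "frag_of (\<phi>, b \<oplus>\<^bsub>B\<^esub> c)" "frag_of (\<phi>, b) + frag_of (\<phi>, c)"]
      by (simp add: kernel_def diff_diff_eq eval_diff eval_add eval_closed a_minus_def B.r_neg)
  qed
  then show ?thesis using assms by (auto simp: kernel_def)
qed

lemma eval_cong:
  assumes "u \<sim> v" "v \<in> F"
  shows "ev p x u = ev p x v"
proof -
  have "ev p x (u - v + v) = \<zero>\<^bsub>B\<^esub> \<oplus>\<^bsub>B\<^esub> ev p x v"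
    using assms eval_add[OF rel_F, of "u - v" v] eval_rel[of "u - v"] unfolding tensor_cong_def by simp
  then show ?thesis using eval_closed[OF assms(2)] by simp
qed

lemma NC_eval_class: "u \<in> F \<Longrightarrow> NC_eval X B p x (tensor_class C B u) = ev p x u"
  unfolding NC_eval_def
  by (rule eval_cong[OF mem_class_cong]) (rule someI_ex, use class_nonempty in blast)

lemma delta_closed: "s \<in> nondegenerate X \<Longrightarrow> delta_cochain s \<in> carrier C"
  unfolding carrier_C
  by (rule X.cochain_carrierI[of "{fst s}"]) (auto simp: delta_cochain_def nondegenerate_def)

text \<open>Away from \<open>nondegenerate X\<close> both sides are zero, since a normalized cochain
  vanishes on degenerate simplices and off \<open>X\<close>.\<close>

lemma cochain_expansion:
  assumes "\<phi> \<in> carrier C"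
  shows "\<phi> = finsum C (\<lambda>s. [\<phi> (fst s) (snd s)] \<cdot>\<^bsub>C\<^esub> delta_cochain s) (nondegenerate X)"
proof (intro ext)
  fix p x
  have cl: "[k] \<cdot>\<^bsub>C\<^esub> delta_cochain s \<in> cochain_carrier X" if "s \<in> nondegenerate X" for s and k :: int
    using X.C.add.int_pow_closed[OF delta_closed[OF that]] carrier_C by auto
  have "finsum C (\<lambda>s. [\<phi> (fst s) (snd s)] \<cdot>\<^bsub>C\<^esub> delta_cochain s) (nondegenerate X) p x =
      (\<Sum>s\<in>nondegenerate X. ([\<phi> (fst s) (snd s)] \<cdot>\<^bsub>C\<^esub> delta_cochain s) p x)"
    by (rule X.finsum_cochains[OF finite_nondegenerate cl])
  also have "\<dots> = (\<Sum>s\<in>nondegenerate X. if s = (p, x) then \<phi> p x else 0)"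
    using delta_closed
    by (intro sum.cong refl) (auto simp: X.add_pow_cochains carrier_C, auto simp: delta_cochain_def split: if_splits)
  also have "\<dots> = \<phi> p x"
    using assms X.cochain_zero[of \<phi> x p]
    by (simp add: sum.delta[OF finite_nondegenerate]) (auto simp: nondegenerate_def carrier_C)
  finally show "\<phi> p x = finsum C (\<lambda>s. [\<phi> (fst s) (snd s)] \<cdot>\<^bsub>C\<^esub> delta_cochain s) (nondegenerate X) p x" ..
qed

text \<open>Normal form of a tensor, with its values as coefficients. For
  \<open>\<phi> \<otimes> b\<close> it comes from expanding \<open>\<phi>\<close> in indicators and
  moving each integer \<open>\<phi>(s)\<close> across to \<open>b\<close>; both sides respect
  differences.\<close>

lemma cong_expansion:
  assumes "u \<in> F"
  shows "u \<sim> (\<Sum>s\<in>nondegenerate X. frag_of (delta_cochain s, ev (fst s) (snd s) u))"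
  using assms[unfolded carrier_free_Abelian_group_iff]
proof (induction u rule: free_Abelian_group_induct[consumes 1, case_names zero diff one])
  case zero
  have "0 \<sim> frag_of (delta_cochain s, \<zero>\<^bsub>B\<^esub>)" if "s \<in> nondegenerate X" for s
    by (rule cong_sym[OF cong_zero_right[OF delta_closed[OF that]]])
  then show ?case
    using cong_sum[of "nondegenerate X" "\<lambda>_. 0" "\<lambda>s. frag_of (delta_cochain s, \<zero>\<^bsub>B\<^esub>)"] by (simp add: eval_zero)
next
  case (one g)
  then obtain \<phi> b where g: "g = (\<phi>, b)" "\<phi> \<in> carrier C" "b \<in> carrier B" by blast
  let ?k = "\<lambda>s. \<phi> (fst s) (snd s)"
  have "frag_of (\<phi>, b) = frag_of (finsum C (\<lambda>s. [?k s] \<cdot>\<^bsub>C\<^esub> delta_cochain s) (nondegenerate X), b)"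
    using cochain_expansion[OF g(2)] by simp
  also have "\<dots> \<sim> (\<Sum>s\<in>nondegenerate X. frag_of ([?k s] \<cdot>\<^bsub>C\<^esub> delta_cochain s, b))"
    by (rule additive_cong_finsum[where f = "\<lambda>\<psi>. frag_of (\<psi>, b)", OF X.C.abelian_group_axioms cong_left finite_nondegenerate])
      (use g(3) delta_closed X.C.add.int_pow_closed in auto)
  also have "\<dots> \<sim> (\<Sum>s\<in>nondegenerate X. frag_cmul (?k s) (frag_of (delta_cochain s, b)))"
    by (rule cong_sum, rule additive_cong_int[where f = "\<lambda>\<psi>. frag_of (\<psi>, b)", OF X.C.abelian_group_axioms cong_left])
      (use g(3) delta_closed in auto)
  also have "\<dots> \<sim> (\<Sum>s\<in>nondegenerate X. frag_of (delta_cochain s, [?k s] \<cdot>\<^bsub>B\<^esub> b))"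
    by (rule cong_sum, rule cong_sym,
        rule additive_cong_int[where f = "\<lambda>b. frag_of (delta_cochain s, b)" for s, OF B.abelian_group_axioms cong_right])
      (use g(3) delta_closed in auto)
  finally show ?case using g by (simp add: eval_frag_of)
next
  case (diff u v)
  have F: "u \<in> F" "v \<in> F" using diff.hyps(1,2) by simp_all
  let ?e = "\<lambda>s u. frag_of (delta_cochain s, ev (fst s) (snd s) u)"
  have "u - v \<sim> (\<Sum>s\<in>nondegenerate X. ?e s u - ?e s v)"
    using cong_diff[OF diff.IH] by (simp only: sum_subtractf)
  also have "\<dots> \<sim> (\<Sum>s\<in>nondegenerate X. ?e s (u - v))"
    unfolding eval_diff[OF F]
    by (rule cong_sum, rule cong_sym,
        rule additive_cong_diff[where f = "\<lambda>b. frag_of (delta_cochain s, b)" for s, OF B.abelian_group_axioms cong_right])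
      (use delta_closed eval_closed F in auto)
  finally show ?case .
qed

lemma NC_carrierE:
  assumes "U \<in> carrier (NC X B)"
  obtains u where "u \<in> F" "U = tensor_class C B u"
  using assms unfolding NC_def carrier_tensor_dg by blast

lemma NC_eval_closed: "U \<in> carrier (NC X B) \<Longrightarrow> NC_eval X B p x U \<in> carrier B"
  by (erule NC_carrierE) (simp only: NC_eval_class eval_closed)

text \<open>Equal values give equal normal forms in \<open>cong_expansion\<close>.\<close>

lemma NC_eqI:
  assumes "U \<in> carrier (NC X B)" "V \<in> carrier (NC X B)"
    and eq: "\<And>p x. x \<in> simplices X p \<Longrightarrow> NC_eval X B p x U = NC_eval X B p x V"
  shows "U = V"
proof -
  obtain u where u: "u \<in> F" "U = tensor_class C B u" using assms(1) by (rule NC_carrierE)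
  obtain v where v: "v \<in> F" "V = tensor_class C B v" using assms(2) by (rule NC_carrierE)
  have *: "ev (fst s) (snd s) u = ev (fst s) (snd s) v" if "s \<in> nondegenerate X" for s
    using eq[of "snd s" "fst s"] that u v by (auto simp: NC_eval_class nondegenerate_def simp del: carrier_free_Abelian_group_iff)
  have "u \<sim> (\<Sum>s\<in>nondegenerate X. frag_of (delta_cochain s, ev (fst s) (snd s) v))"
    using cong_expansion[OF u(1)] * by simp
  then have "u \<sim> v"
    using cong_sym[OF cong_expansion[OF v(1)]] cong_trans by blast
  then show ?thesis using u v class_eq_iff by simp
qed

lemma NC_eval_degenerate:
  assumes U: "U \<in> carrier (NC X B)" and x: "x \<in> degenerate_simplices X p"
  shows "NC_eval X B p x U = \<zero>\<^bsub>B\<^esub>"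
proof -
  obtain u where u: "u \<in> F" "U = tensor_class C B u" using U by (rule NC_carrierE)
  have "ev p x u = \<zero>\<^bsub>B\<^esub>"
    using u(1)[unfolded carrier_free_Abelian_group_iff]
  proof (induction u rule: free_Abelian_group_induct[consumes 1, case_names zero diff one])
    case (one g)
    then obtain \<phi> b where g: "g = (\<phi>, b)" "\<phi> \<in> carrier C" "b \<in> carrier B" by blast
    then have "\<phi> p x = 0" using X.cochain_zero x carrier_C by blast
    then show ?case using g by (simp add: eval_frag_of add_pow_def)
  next
    case (diff a b)
    then show ?case by (simp add: eval_diff a_minus_def)
  qed (rule eval_zero)
  then show ?thesis using u by (simp add: NC_eval_class)
qed

text \<open>The normal form read backwards: indicators tensored with the prescribed values.
  Assumption \<open>deg\<close> takes care of the simplices that carry no indicator.\<close>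

lemma NC_eval_surj:
  assumes g: "\<And>p x. x \<in> simplices X p \<Longrightarrow> g p x \<in> carrier B"
    and deg: "\<And>p x. x \<in> degenerate_simplices X p \<Longrightarrow> g p x = \<zero>\<^bsub>B\<^esub>"
  shows "\<exists>U\<in>carrier (NC X B). \<forall>p. \<forall>x\<in>simplices X p. NC_eval X B p x U = g p x"
proof -
  let ?f = "\<lambda>s. frag_of (delta_cochain s, g (fst s) (snd s))"
  let ?u = "\<Sum>s\<in>nondegenerate X. ?f s"
  have g': "g (fst s) (snd s) \<in> carrier B" if "s \<in> nondegenerate X" for s
    using that g by (auto simp: nondegenerate_def)
  have f: "?f s \<in> F" if "s \<in> nondegenerate X" for s
    using that g' delta_closed by simp
  have u: "?u \<in> F" by (rule sum_closed_free_Abelian_group[OF f])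
  have "ev p x ?u = g p x" if x: "x \<in> simplices X p" for p x
  proof -
    have "ev p x ?u = (\<Oplus>\<^bsub>B\<^esub>s\<in>nondegenerate X. ev p x (?f s))"
      by (rule eval_sum[OF finite_nondegenerate f])
    also have "\<dots> = (\<Oplus>\<^bsub>B\<^esub>s\<in>nondegenerate X. if s = (p, x) then g (fst s) (snd s) else \<zero>\<^bsub>B\<^esub>)"
      by (rule B.add.finprod_cong')
        (use g' delta_closed in \<open>auto simp: eval_frag_of delta_cochain_def[of "(p, x)"]\<close>,
          auto simp: delta_cochain_def add_pow_def split: if_splits)
    also have "\<dots> = g p x"
      using x deg by (subst B.finsum_delta[OF finite_nondegenerate]) (auto simp: g' nondegenerate_def)
    finally show ?thesis .
  qed
  then show ?thesis
    using u by (auto simp: NC_def carrier_tensor_dg NC_eval_class simp del: carrier_free_Abelian_group_iff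
        intro!: bexI[of _ "tensor_class C B ?u"])
qed

text \<open>The indicator of a \<open>p\<close>-simplex has degree \<open>p\<close>, so its
  coefficient in degree \<open>n\<close> has degree \<open>n - p\<close>. Forward, the condition
  passes from generators to the subgroup they generate; backward, the summands of the normal form
  are themselves generators.\<close>

lemma NC_part_iff:
  assumes U: "U \<in> carrier (NC X B)"
  shows "U \<in> dg_part (NC X B) n \<longleftrightarrow> (\<forall>p. \<forall>x\<in>simplices X p. NC_eval X B p x U \<in> dg_part B (n - int p))"
proof -
  let ?G = "{pure_tensor C B \<phi> b | \<phi> b i j. \<phi> \<in> dg_part C i \<and> b \<in> dg_part B j \<and> i + j = n}"
  note simp_del = carrier_free_Abelian_group_iff
  interpret B': additive_subgroup "dg_part B k" B for k by (rule B.part_subgroup)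
  have part: "dg_part (NC X B) n = generate (tensor_group C B) ?G"
    by (simp add: NC_def tensor_dg_def)
  have gens: "\<exists>u\<in>F. V = tensor_class C B u \<and> (\<forall>p x. ev p x u \<in> dg_part B (n - int p))" if "V \<in> ?G" for V
  proof -
    obtain \<phi> b i j where V: "V = pure_tensor C B \<phi> b" "\<phi> \<in> dg_part C i" "b \<in> dg_part B j" "i + j = n"
      using \<open>V \<in> ?G\<close> by blast
    have cl: "\<phi> \<in> carrier C" "b \<in> carrier B" using V X.C.part_closed B.part_closed by auto
    have "[\<phi> p x] \<cdot>\<^bsub>B\<^esub> b \<in> dg_part B (n - int p)" for p x
    proof (cases "int p = i")
      case True
      have "[k] \<cdot>\<^bsub>B\<^esub> b \<in> dg_part B j" for k :: int
        using group.subgroup_int_pow_closed[OF B.a_group B'.a_subgroup V(3)] by (simp add: add_pow_def)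
      moreover have "n - int p = j" using True V(4) by simp
      ultimately show ?thesis by metis
    next
      \<comment> \<open>Outside its degree the cochain is zero, and the value \<open>\<zero>\<close>
        lies in every graded part.\<close>
      case False
      then have "\<phi> p x = 0" using V(2) by (simp add: cochains_def)
      then show ?thesis by (simp add: add_pow_def)
    qed
    then show ?thesis
      using cl V(1) by (intro bexI[of _ "frag_of (\<phi>, b)"]) (auto simp: pure_tensor_def eval_frag_of)
  qed
  have gen_part: "\<exists>u\<in>F. V = tensor_class C B u \<and> (\<forall>p x. ev p x u \<in> dg_part B (n - int p))"
    if "V \<in> generate (tensor_group C B) ?G" for V
    using that
  proof (induction rule: generate.induct)
    case one
    have "0 \<in> F" by simp
    then show ?case by (intro bexI[of _ 0]) (auto simp: tensor_group_one eval_zero)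
  next
    case (incl V)
    then show ?case by (rule gens)
  next
    case (inv V)
    then obtain u where u: "u \<in> F" "V = tensor_class C B u" "\<forall>p x. ev p x u \<in> dg_part B (n - int p)"
      using gens by blast
    have "ev p x (- u) \<in> dg_part B (n - int p)" for p x
      unfolding eval_minus[OF u(1)] using u(3) B'.a_inv_closed by blast
    moreover have "inv\<^bsub>tensor_group C B\<^esub> V = tensor_class C B (- u)"
      unfolding u(2) by (rule tensor_group_inv[OF u(1)])
    ultimately show ?case using F_minus[OF u(1)] by blast
  next
    case (eng V W)
    obtain u v where uv: "u \<in> F" "V = tensor_class C B u" "\<forall>p x. ev p x u \<in> dg_part B (n - int p)"
      "v \<in> F" "W = tensor_class C B v" "\<forall>p x. ev p x v \<in> dg_part B (n - int p)"
      using eng.IH by blast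
    have "ev p x (u + v) \<in> dg_part B (n - int p)" for p x
      unfolding eval_add[OF uv(1,4)] using uv(3,6) B'.a_closed by blast
    moreover have "V \<otimes>\<^bsub>tensor_group C B\<^esub> W = tensor_class C B (u + v)"
      unfolding uv(2,5) by (rule tensor_group_mult[OF uv(1,4)])
    ultimately show ?case using F_add[OF uv(1,4)] by blast
  qed
  have 1: "NC_eval X B p x U \<in> dg_part B (n - int p)" if U_part: "U \<in> dg_part (NC X B) n" for p x
  proof -
    obtain u where "u \<in> F" "U = tensor_class C B u" "\<forall>p x. ev p x u \<in> dg_part B (n - int p)"
      using gen_part[OF U_part[unfolded part]] by (elim bexE conjE)
    then show ?thesis by (simp only: NC_eval_class)
  qed
  have 2: "U \<in> dg_part (NC X B) n" if ev: "\<forall>p. \<forall>x\<in>simplices X p. NC_eval X B p x U \<in> dg_part B (n - int p)"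
  proof -
    obtain u where u: "u \<in> F" "U = tensor_class C B u" using U by (rule NC_carrierE)
    let ?f = "\<lambda>s. frag_of (delta_cochain s, ev (fst s) (snd s) u)"
    have f: "?f s \<in> F" if "s \<in> nondegenerate X" for s
      using delta_closed[OF that] eval_closed[OF u(1)] by simp
    have gen: "tensor_class C B (?f s) \<in> ?G" if s: "s \<in> nondegenerate X" for s
    proof -
      have "delta_cochain s \<in> dg_part C (int (fst s))"
        using delta_closed[OF s] by (simp add: cochains_def) (auto simp: delta_cochain_def)
      moreover have "ev (fst s) (snd s) u \<in> dg_part B (n - int (fst s))"
        using ev s u NC_eval_class by (auto simp: nondegenerate_def)
      ultimately show ?thesis unfolding pure_tensor_def by fastforce
    qed
    \<comment> \<open>Stated for all subsets \<open>S\<close>, so that the normal form is reached by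
      induction on finite sets.\<close>
    have "tensor_class C B (\<Sum>s\<in>S. ?f s) \<in> generate (tensor_group C B) ?G" if "S \<subseteq> nondegenerate X" for S
      using finite_subset[OF that finite_nondegenerate] that
    proof (induction S)
      case empty
      then show ?case using generate.one[of "tensor_group C B"] by (simp add: tensor_group_one)
    next
      case (insert s S)
      have "(\<Sum>s\<in>S. ?f s) \<in> F"
        using insert f by (intro sum_closed_free_Abelian_group) blast
      then have "tensor_class C B (\<Sum>s\<in>insert s S. ?f s) =
          tensor_class C B (?f s) \<otimes>\<^bsub>tensor_group C B\<^esub> tensor_class C B (\<Sum>s\<in>S. ?f s)"
        using insert f[of s] by (simp add: tensor_group_mult del: simp_del)
      then show ?case
        using generate.eng[OF generate.incl[OF gen[of s]]] insert by simp
    qed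
    then have "tensor_class C B (\<Sum>s\<in>nondegenerate X. ?f s) \<in> generate (tensor_group C B) ?G" by blast
    moreover have "U = tensor_class C B (\<Sum>s\<in>nondegenerate X. ?f s)"
      unfolding u(2) class_eq_iff by (rule cong_expansion[OF u(1)])
    ultimately show ?thesis using part by simp
  qed
  show ?thesis using 1 2 by blast
qed

end

section \<open>Functoriality and the canonical map\<close>

locale cochain_map = X: finite_cochains X B + Y: finite_cochains Y B
  for X :: "'x sset" and Y :: "'y sset" and B :: "'b dg_ring" +
  fixes \<Phi> :: "nat \<Rightarrow> 'x \<Rightarrow> 'y"
  assumes sset_hom: "\<Phi> \<in> sset_hom X Y"

sublocale cochain_map \<subseteq> T: tensor_left_map "cochains Y" "cochains X" "cochain_pullback X \<Phi>" B
proof -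
  interpret H: weak_dg_hom "cochains Y" "cochains X" "cochain_pullback X \<Phi>"
    by (rule cochain_pullback_hom[OF X.X.simplicial_set_axioms Y.X.simplicial_set_axioms sset_hom])
  show "tensor_left_map (cochains Y) (cochains X) (cochain_pullback X \<Phi>) B" ..
qed

context cochain_map
begin

lemmas NC_map_closed = T.tensor_map_closed[folded NC_def NC_map_def]
lemmas NC_map_mult = T.tensor_map_mult[folded NC_def NC_map_def]
lemmas NC_map_add = T.tensor_map_add[folded NC_def NC_map_def]
lemmas NC_map_d = T.tensor_map_d[folded NC_def NC_map_def]
lemmas NC_map_one = T.tensor_map_one[folded NC_def NC_map_def]

text \<open>Both sides are additive in a representative and equal the multiple of \<open>b\<close>
  by \<open>\<phi>(\<Phi>(x))\<close> on a generator. On values, pullback is thus composition with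
  \<open>\<Phi>\<close>.\<close>

lemma NC_eval_map:
  assumes "U \<in> carrier (NC Y B)" "x \<in> simplices X p"
  shows "NC_eval X B p x (NC_map X Y B \<Phi> U) = NC_eval Y B p (\<Phi> p x) U"
proof -
  obtain u where u: "u \<in> Y.F" "U = tensor_class (cochains Y) B u"
    using assms(1) by (rule Y.NC_carrierE)
  have map: "NC_map X Y B \<Phi> (tensor_class (cochains Y) B u) = tensor_class (cochains X) B (T.map_rep u)"
    unfolding NC_map_def by (rule T.tensor_map_class[OF u(1)])
  have "X.ev p x (T.map_rep u) = Y.ev p (\<Phi> p x) u"
    using u(1)[unfolded carrier_free_Abelian_group_iff]
  proof (induction u rule: free_Abelian_group_induct[consumes 1, case_names zero diff one])
    case zero
    then show ?case by (simp add: X.eval_zero Y.eval_zero)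
  next
    case (diff u v)
    then show ?case
      using T.map_rep_F[of u] T.map_rep_F[of v] by (simp add: frag_extend_diff X.eval_diff Y.eval_diff)
  next
    case (one g)
    then obtain \<phi> b where g: "g = (\<phi>, b)" "\<phi> \<in> carrier (cochains Y)" "b \<in> carrier B" by blast
    then show ?case
      using T.hom_closed[of \<phi>] assms(2) by (simp add: X.eval_frag_of Y.eval_frag_of) (simp add: cochain_pullback_def)
  qed
  then show ?thesis
    unfolding u(2) map X.NC_eval_class[OF T.map_rep_F[OF u(1)]] Y.NC_eval_class[OF u(1)] .
qed

text \<open>The values of the pullback at \<open>p\<close>-simplices are values of \<open>U\<close>
  at \<open>p\<close>-simplices, so \<open>NC_part_iff\<close> transfers the degree.\<close>

lemma NC_map_part:
  assumes "U \<in> carrier (NC Y B)" "U \<in> dg_part (NC Y B) n"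
  shows "NC_map X Y B \<Phi> U \<in> dg_part (NC X B) n"
  using assms NC_map_closed[OF assms(1)] sset_hom_closed[OF sset_hom]
  by (simp add: X.NC_part_iff Y.NC_part_iff NC_eval_map)

lemma compose_dg_hom:
  assumes "dg_ring A" and h: "h \<in> dg_hom A (NC Y B)"
  shows "compose (carrier A) (NC_map X Y B \<Phi>) h \<in> dg_hom A (NC X B)"
proof -
  interpret A: dg_ring A by fact
  have cl: "h a \<in> carrier (NC Y B)" if "a \<in> carrier A" for a
    using h that by (auto simp: dg_hom_def ring_hom_def)
  show ?thesis
    using h
    by (auto simp: dg_hom_def ring_hom_def compose_def cl A.d_closed A.part_closed
        NC_map_closed NC_map_mult NC_map_add NC_map_d NC_map_one NC_map_part)
qed

end

section \<open>Finiteness of subcomplexes of a simplex\<close>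

lemma finite_mono_maps: "finite (mono_maps p q)"
proof (rule finite_subset)
  show "mono_maps p q \<subseteq> {..p} \<rightarrow>\<^sub>E {..q}" by (auto simp: mono_maps_def)
qed (intro finite_PiE; simp)

text \<open>A nondegenerate simplex is strictly increasing, which bounds its dimension by
  \<open>q\<close>; each dimension contains finitely many maps.\<close>

lemma finite_nondegenerate_subcomplex:
  assumes "simplicial_set X" and sub: "\<And>p. simplices X p \<subseteq> mono_maps p q"
    and act: "act X = act (std_simplex q)"
  shows "finite (nondegenerate X)"
proof -
  interpret simplicial_set X by fact
  have "p \<le> q" if x: "x \<in> simplices X p" "x \<notin> degenerate_simplices X p" for p x
  proof -
    have m: "x \<in> mono_maps p q" using sub x by blast
    have step: "x j < x (Suc j)" if j: "j < p" for j
    proof (rule ccontr)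
      \<comment> \<open>This endomorphism of \<open>[p]\<close> collapses \<open>j + 1\<close> onto
        \<open>j\<close> and fixes \<open>x\<close>. By \<open>degenerate_act\<close> the result is
        degenerate in \<open>X\<close> itself, so no lower-dimensional simplex has to be shown to
        lie in \<open>X\<close>.\<close>
      let ?e = "\<lambda>k\<in>{..p}. if k = Suc j then j else k"
      assume "\<not> x j < x (Suc j)"
      then have eq: "x (Suc j) = x j"
        using mono_maps_mono[OF m, of j "Suc j"] j by simp
      have e: "?e \<in> mono_maps p p"
        by (rule restrict_mono_maps) (use j in auto)
      have "compose {..p} x ?e = x"
        by (rule mono_maps_eqI[OF mono_maps_compose[OF e m] m]) (auto simp: compose_def eq)
      then have "act X p p ?e x = x" by (simp add: act std_simplex_def)
      moreover have "act X p p ?e x \<in> degenerate_simplices X p"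
        by (rule degenerate_act[OF e j _ x(1)]) (use j in auto)
      ultimately show False using x(2) by simp
    qed
    \<comment> \<open>Strict growth gives \<open>k \<le> x k\<close>; at \<open>k = p\<close> this
      reads \<open>p \<le> x p \<le> q\<close>.\<close>
    have "k \<le> p \<Longrightarrow> k \<le> x k" for k
    proof (induction k)
      case (Suc k)
      then show ?case using step[of k] by simp
    qed simp
    then show ?thesis using mono_maps_le[OF m, of p] by force
  qed
  then have "nondegenerate X \<subseteq> (SIGMA p:{..q}. mono_maps p q)"
    using sub by (auto simp: nondegenerate_def)
  then show ?thesis
    by (rule finite_subset) (intro finite_SigmaI finite_mono_maps; simp)
qed

lemma finite_cochains_subcomplex:
  assumes "simplicial_set X" "\<And>p. simplices X p \<subseteq> mono_maps p q" "act X = act (std_simplex q)" "dg_ring B"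
  shows "finite_cochains X B"
proof -
  interpret B: dg_ring B by fact
  show ?thesis
    by (intro finite_cochains.intro finite_cochains_axioms.intro B.weak_dg_ring_axioms
        finite_nondegenerate_subcomplex[OF assms(1-3)] assms(1))
qed

lemma finite_cochains_std_simplex: "dg_ring B \<Longrightarrow> finite_cochains (std_simplex q) B"
  by (rule finite_cochains_subcomplex[OF simplicial_set_std_simplex, of q q]) (auto simp: std_simplex_def)

lemma finite_cochains_horn: "dg_ring B \<Longrightarrow> i \<le> q \<Longrightarrow> finite_cochains (horn q i) B"
  by (rule finite_cochains_subcomplex[OF simplicial_set_horn, of i q q]) (auto simp: horn_def)

section \<open>Yoneda maps and the bijection\<close>

lemma std_map_hom: "f \<in> mono_maps p q \<Longrightarrow> std_map p f \<in> sset_hom (std_simplex p) (std_simplex q)"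
  by (auto simp: sset_hom_def std_map_def std_simplex_def mono_maps_compose mono_maps_compose_assoc)

lemma (in simplicial_set) simplex_map_hom: "x \<in> simplices X p \<Longrightarrow> simplex_map X p x \<in> sset_hom (std_simplex p) X"
  by (auto simp: sset_hom_def simplex_map_def std_simplex_def mono_maps_compose act_closed act_comp)

lemma id_map: "(\<lambda>k\<in>{..p}. k) \<in> mono_maps p p"
  by (rule restrict_mono_maps) auto

lemma compose_id_map: "s \<in> mono_maps r p \<Longrightarrow> compose {..r} (\<lambda>k\<in>{..p}. k) s = s"
  by (rule mono_maps_eqI[OF mono_maps_compose[OF _ id_map]]) (auto simp: compose_def dest: mono_maps_le)

lemma dg_hom_closed: "h \<in> dg_hom A B \<Longrightarrow> a \<in> carrier A \<Longrightarrow> h a \<in> carrier B"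
  by (auto simp: dg_hom_def ring_hom_def)

text \<open>Finitely many nondegenerate simplices is the generality in which elements of
  \<open>N(X, B)\<close> are the same as normalized families of values in \<open>B\<close>.\<close>

theorem canonical_map_bij_betw:
  fixes A :: "'a dg_ring" and B :: "'b dg_ring" and X :: "'x sset"
  assumes A: "dg_ring A" and B: "dg_ring B" and X: "finite_cochains X B"
  shows "bij_betw (canonical_map X A B) (dg_hom A (NC X B)) (sset_hom X (SHom A B))"
proof -
  interpret A: dg_ring A by fact
  interpret X: finite_cochains X B by fact
  let ?D = "std_simplex :: nat \<Rightarrow> (nat \<Rightarrow> nat) sset"
  let ?id = "\<lambda>p. \<lambda>k\<in>{..p}. k :: nat"
  interpret D: finite_cochains "?D p" B for p by (rule finite_cochains_std_simplex[OF B])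
  have D_simplices: "simplices (?D p) r = mono_maps r p" for p r by (simp add: std_simplex_def)
  have yoneda: "cochain_map (?D p) X B (simplex_map X p x)" if "x \<in> simplices X p" for p x
    by (intro cochain_map.intro cochain_map_axioms.intro D.finite_cochains_axioms X
        X.X.simplex_map_hom that)
  have std: "cochain_map (?D p) (?D q) B (std_map p f)" if "f \<in> mono_maps p q" for p q f
    by (intro cochain_map.intro cochain_map_axioms.intro D.finite_cochains_axioms std_map_hom that)
  \<comment> \<open>With \<open>s\<close> the identity of \<open>[p]\<close> this recovers
    \<open>U(x)\<close>; injectivity and the later fact \<open>joint\<close> rest on that
    case.\<close>
  have eval_yoneda: "NC_eval (?D p) B r s (NC_map (?D p) X B (simplex_map X p x) U) = NC_eval X B r (act X r p s x) U"
    if "x \<in> simplices X p" "s \<in> mono_maps r p" "U \<in> carrier (NC X B)" for p r x s U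
    using cochain_map.NC_eval_map[OF yoneda[OF that(1)] that(3), of s r] that(2)
    by (simp add: D_simplices simplex_map_def)
  have eval_std: "NC_eval (?D p) B r s (NC_map (?D p) (?D q) B (std_map p f) U) = NC_eval (?D q) B r (compose {..r} f s) U"
    if "f \<in> mono_maps p q" "s \<in> mono_maps r p" "U \<in> carrier (NC (?D q) B)" for p q r f s U
    using cochain_map.NC_eval_map[OF std[OF that(1)] that(3), of s r] that(2)
    by (simp add: D_simplices std_map_def)
  have yoneda_closed: "NC_map (?D p) X B (simplex_map X p x) U \<in> carrier (NC (?D p) B)"
    if "x \<in> simplices X p" "U \<in> carrier (NC X B)" for p x U
    by (rule cochain_map.NC_map_closed[OF yoneda[OF that(1)] that(2)])
  have std_closed: "NC_map (?D p) (?D q) B (std_map p f) U \<in> carrier (NC (?D p) B)"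
    if "f \<in> mono_maps p q" "U \<in> carrier (NC (?D q) B)" for p q f U
    by (rule cochain_map.NC_map_closed[OF std[OF that(1)] that(2)])

  have maps: "canonical_map X A B h \<in> sset_hom X (SHom A B)" if h: "h \<in> dg_hom A (NC X B)" for h
  proof -
    note h_cl = dg_hom_closed[OF h]
    have 1: "canonical_map X A B h p \<in> simplices X p \<rightarrow>\<^sub>E simplices (SHom A B) p" for p
      using cochain_map.compose_dg_hom[OF yoneda A h]
      by (auto simp: canonical_map_def SHom_def Cyl_def)
    \<comment> \<open>Compared on values: at \<open>s\<close>, both sides give the value of
      \<open>h a\<close> at the simplex obtained from \<open>x\<close> by acting with
      \<open>f\<close> after \<open>s\<close>.\<close>
    have 2: "canonical_map X A B h p (act X p q f x) = act (SHom A B) p q f (canonical_map X A B h q x)"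
      if f: "f \<in> mono_maps p q" and x: "x \<in> simplices X q" for p q f x
    proof -
      have fx: "act X p q f x \<in> simplices X p" by (rule X.X.act_closed[OF f x])
      have "NC_map (?D p) X B (simplex_map X p (act X p q f x)) (h a) =
          NC_map (?D p) (?D q) B (std_map p f) (NC_map (?D q) X B (simplex_map X q x) (h a))"
        if a: "a \<in> carrier A" for a
      proof (rule D.NC_eqI)
        fix r s assume "s \<in> simplices (?D p) r"
        then have s: "s \<in> mono_maps r p" by (simp add: D_simplices)
        show "NC_eval (?D p) B r s (NC_map (?D p) X B (simplex_map X p (act X p q f x)) (h a)) =
            NC_eval (?D p) B r s (NC_map (?D p) (?D q) B (std_map p f) (NC_map (?D q) X B (simplex_map X q x) (h a)))"
          unfolding eval_yoneda[OF fx s h_cl[OF a]] eval_std[OF f s yoneda_closed[OF x h_cl[OF a]]]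
            eval_yoneda[OF x mono_maps_compose[OF s f] h_cl[OF a]] X.X.act_comp[OF s f x] ..
      qed (intro yoneda_closed[OF fx h_cl[OF a]] std_closed[OF f yoneda_closed[OF x h_cl[OF a]]])+
      then show ?thesis
        using fx x by (auto simp: canonical_map_def SHom_def compose_def fun_eq_iff)
    qed
    show ?thesis using 1 2 unfolding sset_hom_def by blast
  qed

  have inj: "h = h'" if h: "h \<in> dg_hom A (NC X B)" and h': "h' \<in> dg_hom A (NC X B)"
    and eq: "canonical_map X A B h = canonical_map X A B h'" for h h'
  proof (rule extensionalityI)
    show "h \<in> extensional (carrier A)" "h' \<in> extensional (carrier A)"
      using h h' by (auto simp: dg_hom_def)
    fix a assume a: "a \<in> carrier A"
    show "h a = h' a"
    proof (rule X.NC_eqI[OF dg_hom_closed[OF h a] dg_hom_closed[OF h' a]])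
      fix p x assume x: "x \<in> simplices X p"
      have "NC_map (?D p) X B (simplex_map X p x) (h a) = NC_map (?D p) X B (simplex_map X p x) (h' a)"
        using fun_cong[OF fun_cong[OF fun_cong[OF eq, of p], of x], of a] x a
        by (simp add: canonical_map_def compose_def)
      then show "NC_eval X B p x (h a) = NC_eval X B p x (h' a)"
        using eval_yoneda[OF x id_map dg_hom_closed[OF h a]] eval_yoneda[OF x id_map dg_hom_closed[OF h' a]]
        by (simp add: X.X.act_id[OF x])
    qed
  qed

  have surj: "\<exists>h\<in>dg_hom A (NC X B). canonical_map X A B h = \<Psi>" if \<Psi>: "\<Psi> \<in> sset_hom X (SHom A B)" for \<Psi>
  proof -
    have \<Psi>_hom: "\<Psi> p x \<in> dg_hom A (NC (?D p) B)" if "x \<in> simplices X p" for p x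
      using sset_hom_closed[OF \<Psi> that] by (simp add: SHom_def Cyl_def)
    note \<Psi>_cl = dg_hom_closed[OF \<Psi>_hom]
    have \<Psi>_act: "\<Psi> p (act X p q f x) a = NC_map (?D p) (?D q) B (std_map p f) (\<Psi> q x a)"
      if "f \<in> mono_maps p q" "x \<in> simplices X q" "a \<in> carrier A" for p q f x a
      using sset_hom_act[OF \<Psi> that(1,2)] that(3) by (simp add: SHom_def compose_def)
    \<comment> \<open>Naturality of \<open>\<Psi>\<close> turns the value at an arbitrary simplex
      \<open>f\<close> of \<open>\<Delta>^q\<close> into a value at a top simplex. Hence the top
      values alone determine \<open>\<Psi>\<close>.\<close>
    have eval_act: "NC_eval (?D p) B p (?id p) (\<Psi> p (act X p q f x) a) = NC_eval (?D q) B p f (\<Psi> q x a)"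
      if "f \<in> mono_maps p q" "x \<in> simplices X q" "a \<in> carrier A" for p q f x a
      using eval_std[OF that(1) id_map \<Psi>_cl[OF that(2,3)]]
      by (simp only: \<Psi>_act[OF that] mono_maps_compose_id[OF that(1)])
    have "\<exists>U\<in>carrier (NC X B). \<forall>p. \<forall>x\<in>simplices X p. NC_eval X B p x U = NC_eval (?D p) B p (?id p) (\<Psi> p x a)"
      if a: "a \<in> carrier A" for a
    proof (rule X.NC_eval_surj)
      show "NC_eval (?D p) B p (?id p) (\<Psi> p x a) \<in> carrier B" if "x \<in> simplices X p" for p x
        by (rule D.NC_eval_closed[OF \<Psi>_cl[OF that a]])
      fix n x assume "x \<in> degenerate_simplices X n"
      then obtain p j y where n: "n = Suc p" and j: "j \<le> p" and y: "y \<in> simplices X p" and x: "x = degen X p j y"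
        by (rule X.X.degenerate_simplicesE)
      let ?s = "\<lambda>k\<in>{..Suc p}. if k \<le> j then k else k - 1"
      \<comment> \<open>By \<open>eval_act\<close>, the value prescribed at
        \<open>degen X p j y\<close> is that of \<open>\<Psi> p y a\<close> at the codegeneracy
        \<open>?s\<close>. As a degeneracy of the identity, \<open>?s\<close> is a degenerate
        simplex of \<open>\<Delta>^p\<close>, so this value is zero.\<close>
      have "?s = degen (?D p) p j (?id p)"
        by (simp add: degen_def std_simplex_def compose_id_map[OF degen_map[OF j]])
      then have "?s \<in> degenerate_simplices (?D p) (Suc p)"
        using j id_map[of p] unfolding degenerate_simplices_def D_simplices by blast
      then show "NC_eval (?D n) B n (?id n) (\<Psi> n x a) = \<zero>\<^bsub>B\<^esub>"
        unfolding n x degen_def eval_act[OF degen_map[OF j] y a]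
        by (rule D.NC_eval_degenerate[OF \<Psi>_cl[OF y a]])
    qed
    then obtain h0 where h0: "\<And>a. a \<in> carrier A \<Longrightarrow> h0 a \<in> carrier (NC X B)"
      "\<And>a p x. \<lbrakk>a \<in> carrier A; x \<in> simplices X p\<rbrakk> \<Longrightarrow>
        NC_eval X B p x (h0 a) = NC_eval (?D p) B p (?id p) (\<Psi> p x a)"
      by metis
    \<comment> \<open>The choice of \<open>h0\<close> is free off the carrier; \<open>dg_hom\<close>
      demands \<open>undefined\<close> there.\<close>
    define h where "h = restrict h0 (carrier A)"
    have h_cl: "h a \<in> carrier (NC X B)" if "a \<in> carrier A" for a
      using h0(1)[OF that] that by (simp add: h_def)
    have h_eval: "NC_eval X B p x (h a) = NC_eval (?D p) B p (?id p) (\<Psi> p x a)"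
      if "a \<in> carrier A" "x \<in> simplices X p" for a p x
      using h0(2)[OF that] that(1) by (simp add: h_def)
    \<comment> \<open>At a simplex \<open>s\<close> the left side is the top value of
      \<open>\<Psi>\<close> at \<open>act X r p s x\<close>, which \<open>eval_act\<close>
      identifies with the value of \<open>\<Psi> p x a\<close> at \<open>s\<close>.\<close>
    have h_yoneda: "NC_map (?D p) X B (simplex_map X p x) (h a) = \<Psi> p x a"
      if a: "a \<in> carrier A" and x: "x \<in> simplices X p" for a p x
    proof (rule D.NC_eqI[OF yoneda_closed[OF x h_cl[OF a]] \<Psi>_cl[OF x a]])
      fix r s assume "s \<in> simplices (?D p) r"
      then have s: "s \<in> mono_maps r p" by (simp add: D_simplices)
      show "NC_eval (?D p) B r s (NC_map (?D p) X B (simplex_map X p x) (h a)) = NC_eval (?D p) B r s (\<Psi> p x a)"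
        unfolding eval_yoneda[OF x s h_cl[OF a]] h_eval[OF a X.X.act_closed[OF s x]]
        by (rule eval_act[OF s x a])
    qed
    \<comment> \<open>Joint injectivity of the pullbacks: an identity in \<open>N(X, B)\<close>
      follows from its images in the cylinders, where \<open>h\<close> becomes the homomorphism
      \<open>\<Psi> p x\<close>.\<close>
    have joint: "U = V" if "U \<in> carrier (NC X B)" "V \<in> carrier (NC X B)"
      "\<And>p x. x \<in> simplices X p \<Longrightarrow>
        NC_map (?D p) X B (simplex_map X p x) U = NC_map (?D p) X B (simplex_map X p x) V" for U V
    proof (rule X.NC_eqI[OF that(1,2)])
      fix p x assume x: "x \<in> simplices X p"
      show "NC_eval X B p x U = NC_eval X B p x V"
        using eval_yoneda[OF x id_map that(1)] eval_yoneda[OF x id_map that(2)] that(3)[OF x]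
        by (simp add: X.X.act_id[OF x])
    qed
    note NC_cl = X.tensor_dg_mult_closed[folded NC_def] X.tensor_dg_add_closed[folded NC_def]
      X.tensor_dg_d_closed[folded NC_def]
    have \<Psi>_ring: "\<Psi> p x (a \<otimes>\<^bsub>A\<^esub> b) = \<Psi> p x a \<otimes>\<^bsub>NC (?D p) B\<^esub> \<Psi> p x b"
        "\<Psi> p x (a \<oplus>\<^bsub>A\<^esub> b) = \<Psi> p x a \<oplus>\<^bsub>NC (?D p) B\<^esub> \<Psi> p x b"
        "\<Psi> p x \<one>\<^bsub>A\<^esub> = \<one>\<^bsub>NC (?D p) B\<^esub>"
        "\<Psi> p x (dg_d A a) = dg_d (NC (?D p) B) (\<Psi> p x a)"
      if "x \<in> simplices X p" "a \<in> carrier A" "b \<in> carrier A" for p x a b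
      using \<Psi>_hom[OF that(1)] that(2,3) by (auto simp: dg_hom_def ring_hom_def)
    have mult: "h (a \<otimes>\<^bsub>A\<^esub> b) = h a \<otimes>\<^bsub>NC X B\<^esub> h b"
      and add: "h (a \<oplus>\<^bsub>A\<^esub> b) = h a \<oplus>\<^bsub>NC X B\<^esub> h b"
      and d: "h (dg_d A a) = dg_d (NC X B) (h a)"
      if a: "a \<in> carrier A" and b: "b \<in> carrier A" for a b
    proof -
      note cl = h_cl[OF a] h_cl[OF b]
      show "h (a \<otimes>\<^bsub>A\<^esub> b) = h a \<otimes>\<^bsub>NC X B\<^esub> h b"
        by (rule joint[OF h_cl[OF A.m_closed[OF a b]] NC_cl(1)[OF cl]])
          (simp only: cochain_map.NC_map_mult[OF yoneda cl] h_yoneda a b A.m_closed \<Psi>_ring(1))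
      show "h (a \<oplus>\<^bsub>A\<^esub> b) = h a \<oplus>\<^bsub>NC X B\<^esub> h b"
        by (rule joint[OF h_cl[OF A.a_closed[OF a b]] NC_cl(2)[OF cl]])
          (simp only: cochain_map.NC_map_add[OF yoneda cl] h_yoneda a b A.a_closed \<Psi>_ring(2))
      show "h (dg_d A a) = dg_d (NC X B) (h a)"
        by (rule joint[OF h_cl[OF A.d_closed[OF a]] NC_cl(3)[OF cl(1)]])
          (simp only: cochain_map.NC_map_d[OF yoneda cl(1)] h_yoneda a A.d_closed \<Psi>_ring(4)[OF _ a b])
    qed
    have one: "h \<one>\<^bsub>A\<^esub> = \<one>\<^bsub>NC X B\<^esub>"
      by (rule joint[OF h_cl[OF A.one_closed] X.tensor_dg_one_closed[folded NC_def]])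
        (simp only: cochain_map.NC_map_one[OF yoneda] h_yoneda A.one_closed \<Psi>_ring(3)[OF _ A.one_closed A.one_closed])
    \<comment> \<open>Membership in a graded part is not an equation, so \<open>joint\<close> does
      not apply; \<open>NC_part_iff\<close> is used twice instead, for the cylinder and for
      \<open>X\<close>.\<close>
    have part: "h a \<in> dg_part (NC X B) n" if a: "a \<in> dg_part A n" for a n
    proof -
      have aA: "a \<in> carrier A" by (rule A.part_closed[OF a])
      have "NC_eval (?D p) B p (?id p) (\<Psi> p x a) \<in> dg_part B (n - int p)" if x: "x \<in> simplices X p" for p x
      proof -
        have "\<Psi> p x a \<in> dg_part (NC (?D p) B) n" using \<Psi>_hom[OF x] a by (auto simp: dg_hom_def)
        then show ?thesis
          using D.NC_part_iff[OF \<Psi>_cl[OF x aA]] id_map D_simplices by blast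
      qed
      then show ?thesis unfolding X.NC_part_iff[OF h_cl[OF aA]] by (simp add: h_eval[OF aA])
    qed
    have "h \<in> dg_hom A (NC X B)"
      using mult add d one part h_cl by (auto simp: dg_hom_def ring_hom_def h_def)
    moreover have "canonical_map X A B h = \<Psi>"
    proof (intro ext)
      fix p x a
      \<comment> \<open>Off \<open>X\<close> and off the carrier of \<open>A\<close>, both sides are
        \<open>undefined\<close> by the extensionality built into \<open>sset_hom\<close> and
        \<open>dg_hom\<close>.\<close>
      show "canonical_map X A B h p x a = \<Psi> p x a"
      proof (cases "x \<in> simplices X p")
        case x: True
        show ?thesis
        proof (cases "a \<in> carrier A")
          case True
          then show ?thesis using x h_yoneda by (simp add: canonical_map_def compose_def)
        next
          case False
          then have "\<Psi> p x a = undefined" using \<Psi>_hom[OF x] by (auto simp: dg_hom_def extensional_def)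
          then show ?thesis using x False by (simp add: canonical_map_def compose_def)
        qed
      next
        case False
        moreover have "\<Psi> p \<in> extensional (simplices X p)" using \<Psi> by (auto simp: sset_hom_def PiE_def)
        ultimately show ?thesis by (simp add: canonical_map_def extensional_def)
      qed
    qed
    ultimately show ?thesis by blast
  qed

  show ?thesis
    unfolding bij_betw_def inj_on_def using maps inj surj by (auto simp: image_iff) metis
qed

text \<open>A horn is a subcomplex of \<open>\<Delta>^q\<close>, so it has finitely many
  nondegenerate simplices.\<close>

theorem theorem0p5:
  fixes A :: "'a dg_ring" and B :: "'b dg_ring" and q i :: nat
  assumes "dg_ring A" and "dg_ring B" and "i \<le> q"
  shows "bij_betw (canonical_map (horn q i) A B)
           (dg_hom A (NC (horn q i) B))
           (sset_hom (horn q i) (SHom A B))"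
  using assms by (intro canonical_map_bij_betw finite_cochains_horn)

end
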